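(* Let $T_{123}$ be a set of patterns, each of which begins with the prefix $123$, and let $T_{321}$ be the set of patterns obtained by replacing, in each pattern in $T_{123}$, the prefix $123$ with the prefix $321$. For a shape $\mu$ and a set $T$ of patterns, let $\mu_{sym}(T)$ be the number of symmetric full placements on $\mu$ which avoid every pattern in $T$. Then for every self-conjugate shape $\mu$, $$\mu_{sym}(T_{123})=\mu_{sym}(T_{321}).$$
   Context: A shape is a Ferrers shape $\lambda=(\lambda_1\ge\lambda_2\ge\cdots\ge\lambda_k>0)$, coordinatized from the bottom left corner: box $(x,y)$ (column $x$ from the left, row $y$ from the bottom) belongs to $\lambda$ iff $1\le y\le k$ and $1\le x\le\lambda_y$. It is self-conjugate if $(x,y)\in\lambda$ iff $(y,x)\in\lambda$. A placement on $\lambda$ is an assignment of dots to some boxes of $\lambda$ such that no row or column contains more than one dot; it is full if each row and each column of $\lambda$ contains exactly one dot. A placement on a self-conjugate shape is symmetric if it has a dot in $(x,y)$ iff it has a dot in $(y,x)$. The pattern of a sequence of $m$ distinct numbers is its order-preserving relabelling by $1,\dots,m$. A pattern is a permutation $\sigma\in\mathcal{S}_m$ written in one-line notation. A placement on $\lambda$ contains $\sigma\in\mathcal{S}_m$ if there are $m$ dots $(x_1,y_1),\dots,(x_m,y_m)$ in the placement with $x_1<\cdots<x_m$, with the pattern of $y_1\ldots y_m$ equal to $\sigma$, and all lying in a rectangular subshape of $\lambda$ (i.e. the box $(\max_i x_i,\max_i y_i)$ lies in $\lambda$). Otherwise it avoids $\sigma$. A pattern begins with the prefix $123$ if it is of the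 form $123\tau_4\ldots\tau_k$ with $k\ge 3$ and $\tau=\tau_4\ldots\tau_k$ an ordering of $\{4,\dots,k\}$; replacing the prefix by $321$ gives $321\tau_4\ldots\tau_k$. *)

theory Defs
  imports "HOL-Combinatorics.Multiset_Permutations" "HOL-Library.Sublist"
begin

text \<open>A Ferrers shape is the list of its row lengths, from the bottom row upwards; rows and
  columns are numbered from 1, and a box is a pair (column, row). The empty shape is allowed.\<close>

definition is_shape :: "nat list \<Rightarrow> bool" where
  "is_shape l \<longleftrightarrow> sorted_wrt (\<ge>) l \<and> (\<forall>r\<in>set l. r > 0)"

definition boxes :: "nat list \<Rightarrow> (nat \<times> nat) set" where
  "boxes l = {(x, y). 1 \<le> y \<and> y \<le> length l \<and> 1 \<le> x \<and> x \<le> l ! (y - 1)}"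

definition self_conjugate :: "nat list \<Rightarrow> bool" where
  "self_conjugate l \<longleftrightarrow> (\<forall>x y. (x, y) \<in> boxes l \<longleftrightarrow> (y, x) \<in> boxes l)"

text \<open>A placement is identified with the set of boxes carrying a dot.\<close>

definition placement :: "nat list \<Rightarrow> (nat \<times> nat) set \<Rightarrow> bool" where
  "placement l P \<longleftrightarrow> P \<subseteq> boxes l
     \<and> (\<forall>x y y'. (x, y) \<in> P \<longrightarrow> (x, y') \<in> P \<longrightarrow> y = y')
     \<and> (\<forall>x x' y. (x, y) \<in> P \<longrightarrow> (x', y) \<in> P \<longrightarrow> x = x')"

definition full_placement :: "nat list \<Rightarrow> (nat \<times> nat) set \<Rightarrow> bool" where
  "full_placement l P \<longleftrightarrow> placement l P
     \<and> (\<forall>x\<in>fst ` boxes l. \<exists>!y. (x, y) \<in> P)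
     \<and> (\<forall>y\<in>snd ` boxes l. \<exists>!x. (x, y) \<in> P)"

definition symmetric_placement :: "(nat \<times> nat) set \<Rightarrow> bool" where
  "symmetric_placement P \<longleftrightarrow> (\<forall>x y. (x, y) \<in> P \<longleftrightarrow> (y, x) \<in> P)"

text \<open>Patterns are permutations of 1, ..., m in one-line notation.\<close>

definition is_pattern :: "nat list \<Rightarrow> bool" where
  "is_pattern \<sigma> \<longleftrightarrow> \<sigma> \<in> permutations_of_set {1..length \<sigma>}"

text \<open>For a sequence of distinct numbers, each entry is relabelled by its rank among the
  entries, counted from 1.\<close>

definition pattern_of :: "nat list \<Rightarrow> nat list" where
  "pattern_of ys = map (\<lambda>a. card {b \<in> set ys. b \<le> a}) ys"

text \<open>Only used for nonempty patterns: for an empty list of dots the two maxima are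
  unspecified.\<close>

definition contains_pattern :: "nat list \<Rightarrow> (nat \<times> nat) set \<Rightarrow> nat list \<Rightarrow> bool" where
  "contains_pattern l P \<sigma> \<longleftrightarrow>
     (\<exists>ds. length ds = length \<sigma> \<and> set ds \<subseteq> P
        \<and> sorted_wrt (<) (map fst ds)
        \<and> pattern_of (map snd ds) = \<sigma>
        \<and> (Max (fst ` set ds), Max (snd ` set ds)) \<in> boxes l)"

definition avoids_all :: "nat list \<Rightarrow> (nat \<times> nat) set \<Rightarrow> nat list set \<Rightarrow> bool" where
  "avoids_all l P T \<longleftrightarrow> (\<forall>\<sigma>\<in>T. \<not> contains_pattern l P \<sigma>)"

definition sym_avoiders :: "nat list \<Rightarrow> nat list set \<Rightarrow> (nat \<times> nat) set set" where
  "sym_avoiders l T =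
     {P. full_placement l P \<and> symmetric_placement P \<and> avoids_all l P T}"

definition sym_count :: "nat list \<Rightarrow> nat list set \<Rightarrow> nat" where
  "sym_count l T = card (sym_avoiders l T)"

definition replace_123_by_321 :: "nat list \<Rightarrow> nat list" where
  "replace_123_by_321 \<sigma> = [3, 2, 1] @ drop 3 \<sigma>"

lemma finite_boxes: "finite (boxes l)"
proof -
  have "boxes l \<subseteq> (\<Union>y\<in>{1..length l}. (\<lambda>x. (x, y)) ` {1..l ! (y - 1)})"
    by (auto simp: boxes_def)
  then show ?thesis
    by (rule finite_subset) auto
qed

lemma finite_sym_avoiders: "finite (sym_avoiders l T)"
proof -
  have "sym_avoiders l T \<subseteq> Pow (boxes l)"
    by (auto simp: sym_avoiders_def full_placement_def placement_def)
  then show ?thesis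
    using finite_boxes finite_subset by blast
qed

end

(*
  Growth diagrams in the spirit of Fomin and Krattenthaler.  A symmetric placement avoiding all
  123-tau is a symmetric placement whose restriction to a smaller self-conjugate shape avoids 123:
  the smaller shape consists of the boxes that see a copy of a tail tau (or of its inverse) to
  their north-east, and it depends only on the dots outside it.  So it suffices to trade 123 for
  321 inside a shape, keeping the occupied rows and columns.

  For that, label every lattice point on the boundary of the shape by the number of dots to its
  south-west and the length of a longest increasing (for 321-avoiders) or decreasing (for
  123-avoiders) sequence of them; this encodes a two-row partition.  Removing corner boxes one at a
  time, local rules show that in both cases the boundary labels determine the placement and that
  every locally consistent labelling occurs.  Transposing a placement reflects its labels, hence
  symmetric placements correspond to symmetric labellings, in both cases.
*)
theory Submission
  imports Defs
begin

section \<open>Chains of dots in a rectangle\<close>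

text \<open>\<open>width r\<close> measures sequences of the type opposite to \<open>r\<close>.
  Forbidding three-chains of \<open>r\<close> bounds the number of dots by twice the width, so width
  and count together carry a whole partition with two parts.

  Only the inverse local rule is written down. It is checked against actual placements, and its
  injectivity in the north-east label stands in for a forward rule: in the existence proof the
  actual corner label and the prescribed one have the same output under the inverse rule, so they
  coincide.

  The obstacle on the pattern side is that the smaller shape varies with the placement. Rearranging
  the dots inside it must neither move it nor put two dots into one column. The dot counts in the
  labels take care of the columns, since the increment along the top edge of a column tells whether
  the column is occupied; rows follow by symmetry. Inside the smaller shape a full placement is in
  general only partial, so the growth diagrams treat partial placements throughout.\<close>

definition inc :: "nat \<times> nat \<Rightarrow> nat \<times> nat \<Rightarrow> bool" where
  "inc p q \<longleftrightarrow> fst p < fst q \<and> snd p < snd q"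

definition dec :: "nat \<times> nat \<Rightarrow> nat \<times> nat \<Rightarrow> bool" where
  "dec p q \<longleftrightarrow> fst p < fst q \<and> snd q < snd p"

section \<open>Partial permutations, free sets and their largest size\<close>

definition partial_perm :: "(nat \<times> nat) set \<Rightarrow> bool" where
  "partial_perm P \<longleftrightarrow> inj_on fst P \<and> inj_on snd P"

definition below :: "(nat \<times> nat) set \<Rightarrow> nat \<Rightarrow> nat \<Rightarrow> (nat \<times> nat) set" where
  "below P a b = {p \<in> P. fst p \<le> a \<and> snd p \<le> b}"

definition free :: "('a \<Rightarrow> 'a \<Rightarrow> bool) \<Rightarrow> 'a set \<Rightarrow> bool" where
  "free r C \<longleftrightarrow> (\<forall>p\<in>C. \<forall>q\<in>C. \<not> r p q)"

text \<open>For dots in distinct rows and columns, an \<open>inc\<close>-free set is a decreasing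
  sequence and a \<open>dec\<close>-free set an increasing one. So \<open>width\<close> is the
  length of a longest such sequence when \<open>S\<close> is finite.\<close>

definition width :: "('a \<Rightarrow> 'a \<Rightarrow> bool) \<Rightarrow> 'a set \<Rightarrow> nat" where
  "width r S = Max (card ` {C. C \<subseteq> S \<and> free r C})"

definition no_three_chain :: "('a \<Rightarrow> 'a \<Rightarrow> bool) \<Rightarrow> 'a set \<Rightarrow> bool" where
  "no_three_chain r S \<longleftrightarrow> (\<forall>p\<in>S. \<forall>q\<in>S. \<forall>s\<in>S. \<not> (r p q \<and> r q s))"

lemma free_subset: "free r D \<Longrightarrow> C \<subseteq> D \<Longrightarrow> free r C"
  by (auto simp: free_def)

lemma free_insert:
  "free r (insert p C) \<longleftrightarrow> free r C \<and> \<not> r p p \<and> (\<forall>c\<in>C. \<not> r p c \<and> \<not> r c p)"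
  unfolding free_def by blast

lemma free_Un:
  "free r (A \<union> B) \<longleftrightarrow> free r A \<and> free r B \<and> (\<forall>a\<in>A. \<forall>b\<in>B. \<not> r a b \<and> \<not> r b a)"
  unfolding free_def by blast

lemma no_three_chain_subset: "no_three_chain r D \<Longrightarrow> C \<subseteq> D \<Longrightarrow> no_three_chain r C"
  unfolding no_three_chain_def by blast

lemma no_three_chainD:
  "no_three_chain r S \<Longrightarrow> {u, v, w} \<subseteq> S \<Longrightarrow> r u v \<Longrightarrow> r v w \<Longrightarrow> False"
  unfolding no_three_chain_def by auto

lemma width_ge:
  assumes "finite S" "C \<subseteq> S" "free r C"
  shows "card C \<le> width r S"
  unfolding width_def using assms by (intro Max_ge) auto

lemma width_obtain:
  assumes "finite S"
  obtains C where "C \<subseteq> S" "free r C" "card C = width r S" "finite C"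
proof -
  have "width r S \<in> card ` {C. C \<subseteq> S \<and> free r C}"
    unfolding width_def using assms by (intro Max_in) (auto simp: free_def)
  then obtain C where "C \<subseteq> S" "free r C" "card C = width r S" by auto
  then show ?thesis
    using that assms finite_subset by blast
qed

lemma width_le:
  assumes "finite S" "\<And>C. C \<subseteq> S \<Longrightarrow> free r C \<Longrightarrow> card C \<le> n"
  shows "width r S \<le> n"
  by (metis assms width_obtain)

lemma width_mono:
  assumes "finite S'" "S \<subseteq> S'"
  shows "width r S \<le> width r S'"
  by (meson assms finite_subset order_trans width_ge width_le)

lemma width_le_card: "finite S \<Longrightarrow> width r S \<le> card S"
  by (simp add: card_mono width_le)

lemma width_insert_le:
  assumes "finite S"
  shows "width r (insert d S) \<le> Suc (width r S)"
proof (rule width_le)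
  fix C assume C: "C \<subseteq> insert d S" "free r C"
  have "card (C - {d}) \<le> width r S"
    using C assms by (intro width_ge) (auto simp: free_def)
  moreover have "card C \<le> Suc (card (C - {d}))"
    using diff_card_le_card_Diff[of "{d}" C] by simp
  ultimately show "card C \<le> Suc (width r S)" by simp
qed (use assms in auto)

text \<open>Mirsky's layering with two layers: the elements without a predecessor form a free set,
  and so do the others, because a relation between two of them would extend downwards to a
  three-chain.\<close>

lemma card_le_twice_width:
  assumes "finite S" "no_three_chain r S"
  shows "card S \<le> 2 * width r S"
proof -
  define M where "M = {p \<in> S. \<forall>q\<in>S. \<not> r q p}"
  have "card M \<le> width r S"
    using assms(1) by (intro width_ge) (auto simp: M_def free_def)
  moreover have "card (S - M) \<le> width r S"
  proof (rule width_ge[OF assms(1)])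
    show "free r (S - M)"
      using assms(2) unfolding M_def free_def no_three_chain_def by blast
  qed blast
  moreover have "card S = card M + card (S - M)"
  proof -
    have "S \<inter> M = M" unfolding M_def by blast
    then show ?thesis using card_Int_Diff[OF assms(1), of M] by simp
  qed
  ultimately show ?thesis by simp
qed

lemma free_if_width_eq_card:
  assumes "finite S" "width r S = card S"
  shows "free r S"
  by (metis assms card_subset_eq width_obtain)

lemma width_eq_card_if_free:
  "finite S \<Longrightarrow> free r S \<Longrightarrow> width r S = card S"
  by (simp add: le_antisym width_ge width_le_card)

text \<open>The dots south-west of the north-east corner of an empty cell: \<open>p\<close> is the dot in the row
  of the cell, \<open>q\<close> the dot in its column, and \<open>S\<close> consists of the others.\<close>

definition hook :: "(nat \<times> nat) set \<Rightarrow> nat \<times> nat \<Rightarrow> nat \<times> nat \<Rightarrow> bool" where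
  "hook S p q \<longleftrightarrow> finite S \<and> partial_perm (insert p (insert q S)) \<and> p \<notin> S \<and> q \<notin> S
     \<and> dec p q \<and> (\<forall>s\<in>S. fst s < fst q \<and> snd s < snd p)"

lemma hook_trichotomy:
  assumes "hook S p q" "u \<in> insert p (insert q S)" "v \<in> insert p (insert q S)" "u \<noteq> v"
  shows "inc u v \<or> inc v u \<or> dec u v \<or> dec v u"
proof -
  have "fst u \<noteq> fst v" "snd u \<noteq> snd v"
    using assms unfolding hook_def partial_perm_def by (meson inj_onD)+
  then show ?thesis by (auto simp: inc_def dec_def)
qed

text \<open>A free set larger than \<open>width r S\<close> has to use \<open>p\<close>; what is
  left after deleting \<open>p\<close> is a maximum free subset of \<open>S\<close> that
  \<open>p\<close> extends.\<close>

lemma width_insert_grow: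
  assumes "finite S" "width r (insert p S) = Suc (width r S)"
  obtains C where "C \<subseteq> S" "free r (insert p C)" "card C = width r S" "finite C"
proof -
  obtain D where D: "D \<subseteq> insert p S" "free r D" "card D = Suc (width r S)" "finite D"
    by (metis assms finite_insert width_obtain)
  have "p \<in> D"
    using D assms width_ge[of S D r] by fastforce
  show ?thesis
  proof (rule that[of "D - {p}"])
    show "free r (insert p (D - {p}))" using D \<open>p \<in> D\<close> by (simp add: insert_absorb)
    show "card (D - {p}) = width r S" using D \<open>p \<in> D\<close> by simp
  qed (use D in auto)
qed

lemma hook_simps:
  assumes "hook S p q"
  shows "finite S" "p \<notin> S" "q \<notin> S" "fst p < fst q" "snd q < snd p" "p \<noteq> q"
    "\<And>s. s \<in> S \<Longrightarrow> fst s < fst q" "\<And>s. s \<in> S \<Longrightarrow> snd s < snd p"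
    "\<And>s. s \<in> S \<Longrightarrow> fst s \<noteq> fst p" "\<And>s. s \<in> S \<Longrightarrow> snd s \<noteq> snd q"
    "partial_perm S"
proof -
  show hs: "finite S" "p \<notin> S" "q \<notin> S" "fst p < fst q" "snd q < snd p"
    "\<And>s. s \<in> S \<Longrightarrow> fst s < fst q" "\<And>s. s \<in> S \<Longrightarrow> snd s < snd p"
    using assms by (auto simp: hook_def dec_def)
  then show "p \<noteq> q" by blast
  have pp: "partial_perm (insert p (insert q S))" using assms by (simp add: hook_def)
  show "partial_perm S"
    using pp by (simp add: partial_perm_def)
  show "fst s \<noteq> fst p" if "s \<in> S" for s
    using pp that hs(2) unfolding partial_perm_def by (metis inj_onD insertCI)
  show "snd s \<noteq> snd q" if "s \<in> S" for s
    using pp that hs(3) unfolding partial_perm_def by (metis inj_onD insertCI)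
qed

section \<open>Hooks without descending three-chains\<close>

lemma hook_dec_free_top:
  assumes h: "hook S p q" and C: "C \<subseteq> S" "free dec (insert p C)" "c \<in> C"
  shows "fst c < fst p"
proof (rule ccontr)
  assume "\<not> ?thesis"
  then have "dec p c" using hook_simps[OF h] C(1,3) unfolding dec_def by (metis nat_neq_iff subsetD)
  then show False using C by (auto simp: free_def)
qed

lemma hook_dec_free_right:
  assumes h: "hook S p q" and C: "C \<subseteq> S" "free dec (insert q C)" "c \<in> C"
  shows "snd c < snd q"
proof (rule ccontr)
  assume "\<not> ?thesis"
  then have "dec c q" using hook_simps[OF h] C(1,3) unfolding dec_def by (metis nat_neq_iff subsetD)
  then show False using C by (auto simp: free_def)
qed

text \<open>In the absence of a three-chain no dot lies both to the right of \<open>p\<close> and above \<open>q\<close>,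
  so an increasing sequence of \<open>S\<close> stays left of \<open>p\<close> or below \<open>q\<close>, and is extended by
  \<open>p\<close> or by \<open>q\<close>.\<close>

lemma hook_dec_grow:
  assumes h: "hook S p q" and av: "no_three_chain dec (insert p (insert q S))"
  shows "width dec (insert p S) = Suc (width dec S) \<or> width dec (insert q S) = Suc (width dec S)"
proof -
  note hs = hook_simps[OF h]
  obtain C where C: "C \<subseteq> S" "free dec C" "card C = width dec S" "finite C"
    using hs(1) width_obtain by blast
  have mid: "fst s < fst p \<or> snd s < snd q" if "s \<in> S" for s
  proof (rule ccontr)
    assume "\<not> ?thesis"
    then have "fst p < fst s" "snd q < snd s"
      using hs(9)[OF that] hs(10)[OF that] by linarith+
    then have "dec p s" "dec s q" using hs(7,8)[OF that] by (auto simp: dec_def)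
    then show False using av that unfolding no_three_chain_def by blast
  qed
  have "(\<forall>c\<in>C. fst c < fst p) \<or> (\<forall>c\<in>C. snd c < snd q)"
  proof (rule ccontr)
    assume "\<not> ?thesis"
    then obtain u v where uv: "u \<in> C" "v \<in> C" "\<not> fst u < fst p" "\<not> snd v < snd q" by blast
    then have "dec v u"
      using mid[of u] mid[of v] C(1) unfolding dec_def by fastforce
    then show False using C uv by (auto simp: free_def)
  qed
  then show ?thesis
  proof
    assume a: "\<forall>c\<in>C. fst c < fst p"
    have "\<not> dec p c \<and> \<not> dec c p" if "c \<in> C" for c
      using a that hs(8)[of c] C(1) unfolding dec_def by (meson less_asym subsetD)
    then have "free dec (insert p C)"
      using C(2) by (auto simp: free_insert dec_def)
    then have "card (insert p C) \<le> width dec (insert p S)"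
      using C hs(1) by (intro width_ge) auto
    moreover have "p \<notin> C" using C(1) hs(2,3) by blast
    ultimately have "Suc (width dec S) \<le> width dec (insert p S)"
      using C(3,4) by simp
    then show ?thesis using width_insert_le[OF hs(1)] le_antisym by blast
  next
    assume a: "\<forall>c\<in>C. snd c < snd q"
    have "\<not> dec q c \<and> \<not> dec c q" if "c \<in> C" for c
      using a that hs(7)[of c] C(1) unfolding dec_def by (meson less_asym subsetD)
    then have "free dec (insert q C)"
      using C(2) by (auto simp: free_insert dec_def)
    then have "card (insert q C) \<le> width dec (insert q S)"
      using C hs(1) by (intro width_ge) auto
    moreover have "q \<notin> C" using C(1) hs(2,3) by blast
    ultimately have "Suc (width dec S) \<le> width dec (insert q S)"
      using C(3,4) by simp
    then show ?thesis using width_insert_le[OF hs(1)] le_antisym by blast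
  qed
qed

text \<open>Since \<open>dec p q\<close>, no free set contains both dots.\<close>

lemma hook_dec_width:
  assumes h: "hook S p q"
  shows "width dec (insert p (insert q S)) = max (width dec (insert p S)) (width dec (insert q S))"
proof (rule antisym)
  note hs = hook_simps[OF h]
  show "width dec (insert p (insert q S)) \<le> max (width dec (insert p S)) (width dec (insert q S))"
  proof (rule width_le)
    fix C assume C: "C \<subseteq> insert p (insert q S)" "free dec C"
    have "\<not> (p \<in> C \<and> q \<in> C)" using C(2) h by (auto simp: free_def hook_def)
    then have "C \<subseteq> insert p S \<or> C \<subseteq> insert q S" using C by blast
    then show "card C \<le> max (width dec (insert p S)) (width dec (insert q S))"
      using C(2) hs(1) by (metis finite_insert max.coboundedI1 max.coboundedI2 width_ge)
  qed (use hs in auto)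
  show "max (width dec (insert p S)) (width dec (insert q S)) \<le> width dec (insert p (insert q S))"
    using hs(1) by (auto intro!: width_mono)
qed

text \<open>A new three-chain must start at \<open>p\<close> and end at \<open>q\<close>, with a
  middle dot \<open>m\<close> of \<open>S\<close>. Suppose that \<open>p\<close> extends a maximum
  increasing sequence of \<open>S\<close>. That sequence lies left of \<open>p\<close>, hence left
  of \<open>m\<close>, and none of its dots is above \<open>m\<close>, as it would form a
  three-chain with \<open>m\<close> and \<open>q\<close>. So \<open>m\<close> extends the sequence
  inside \<open>S\<close>, against maximality. If \<open>q\<close> is the extending dot, the
  argument is the same with the roles of rows and columns exchanged.\<close>

lemma hook_dec_avoid:
  assumes h: "hook S p q"
    and avp: "no_three_chain dec (insert p S)" and avq: "no_three_chain dec (insert q S)"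
    and grow: "width dec (insert p S) = Suc (width dec S) \<or> width dec (insert q S) = Suc (width dec S)"
  shows "no_three_chain dec (insert p (insert q S))"
proof -
  note hs = hook_simps[OF h]
  have tri: "s = t \<or> inc s t \<or> inc t s \<or> dec s t \<or> dec t s" if "s \<in> S" "t \<in> S" for s t
    using hook_trichotomy[OF h, of s t] that by blast
  have mid: "\<not> (fst p < fst m \<and> snd q < snd m)" if m: "m \<in> S" for m
  proof
    assume pm: "fst p < fst m \<and> snd q < snd m"
    then have dpq: "dec p m" "dec m q" using hs m unfolding dec_def by auto
    have above: False if "C \<subseteq> S" "card C = width dec S" "free dec C" "\<forall>t\<in>C. inc t m" for C
    proof -
      have "m \<notin> C" using that by (auto simp: inc_def)
      have "free dec (insert m C)"
        using that by (fastforce simp: free_def inc_def dec_def)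
      then have "card (insert m C) \<le> width dec S"
        using m that hs(1) by (intro width_ge) auto
      then show False
        using that \<open>m \<notin> C\<close> by (simp add: finite_subset[OF _ hs(1)])
    qed
    from grow show False
    proof
      assume "width dec (insert p S) = Suc (width dec S)"
      from this obtain C where C: "C \<subseteq> S" "free dec (insert p C)" "card C = width dec S"
        by (rule width_insert_grow[OF hs(1)])
      have "inc t m" if t: "t \<in> C" for t
      proof -
        have tp: "fst t < fst p" using hook_dec_free_top h C t by blast
        have "\<not> dec t m"
          using avq dpq t C(1) m unfolding no_three_chain_def by blast
        then show ?thesis using tri[of t m] subsetD[OF C(1) t] m tp pm by (auto simp: inc_def dec_def)
      qed
      then show False using above C free_subset by blast
    next
      assume "width dec (insert q S) = Suc (width dec S)"
      then obtain C where C: "C \<subseteq> S" "free dec (insert q C)" "card C = width dec S"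
        by (rule width_insert_grow[OF hs(1)])
      have "inc t m" if t: "t \<in> C" for t
      proof -
        have tp: "snd t < snd q" using hook_dec_free_right h C t by blast
        have "\<not> dec m t"
          using avp dpq t C(1) m unfolding no_three_chain_def by blast
        then show ?thesis using tri[of t m] subsetD[OF C(1) t] m tp pm by (auto simp: inc_def dec_def)
      qed
      then show False using above C free_subset by blast
    qed
  qed
  show ?thesis
    unfolding no_three_chain_def
  proof (intro ballI notI)
    fix u v w assume uvw: "u \<in> insert p (insert q S)" "v \<in> insert p (insert q S)"
      "w \<in> insert p (insert q S)" and c: "dec u v \<and> dec v w"
    have "\<not> {u, v, w} \<subseteq> insert p S" "\<not> {u, v, w} \<subseteq> insert q S"
      using no_three_chainD avp avq c by metis+
    then have pq: "p \<in> {u, v, w}" "q \<in> {u, v, w}" using uvw by blast+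
    have "\<not> dec z p" "\<not> dec q z" if "z \<in> insert p (insert q S)" for z
      using that hs(4,5) hs(7,8)[of z] by (auto simp: dec_def)
    from this[OF uvw(1)] this[OF uvw(2)] this[OF uvw(3)] c
    have "v \<noteq> p" "v \<noteq> q" "w \<noteq> p" "u \<noteq> q" by auto
    then have "u = p" "w = q" "v \<in> S" using pq uvw by auto
    then show False using mid[of v] c unfolding dec_def by blast
  qed
qed

section \<open>Hooks without ascending three-chains\<close>

lemma hook_inc_unrelated:
  assumes h: "hook S p q" and z: "z \<in> insert p (insert q S)"
  shows "\<not> inc p z" "\<not> inc q z"
  using z hook_simps(4,5)[OF h] hook_simps(7,8)[OF h, of z] by (auto simp: inc_def)

text \<open>No dot lies north-east of \<open>p\<close> or of \<open>q\<close>, so each of them can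
  only be the last dot of a chain, and a chain uses at most one of them.\<close>

lemma hook_inc_avoid:
  assumes h: "hook S p q"
    and avp: "no_three_chain inc (insert p S)" and avq: "no_three_chain inc (insert q S)"
  shows "no_three_chain inc (insert p (insert q S))"
  unfolding no_three_chain_def
proof (intro ballI notI)
  fix u v w assume uvw: "u \<in> insert p (insert q S)" "v \<in> insert p (insert q S)"
    "w \<in> insert p (insert q S)" and c: "inc u v \<and> inc v w"
  have "u \<noteq> p" "u \<noteq> q" "v \<noteq> p" "v \<noteq> q"
    using c hook_inc_unrelated[OF h uvw(2)] hook_inc_unrelated[OF h uvw(3)] by auto
  then have "{u, v, w} \<subseteq> insert p S \<or> {u, v, w} \<subseteq> insert q S" using uvw by auto
  then show False using no_three_chainD avp avq c by metis
qed

lemma hook_inc_free_top: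
  assumes h: "hook S p q" and C: "C \<subseteq> S" "free inc (insert p C)" "c \<in> C"
  shows "fst p < fst c"
proof (rule ccontr)
  assume "\<not> ?thesis"
  then have "inc c p"
    using hook_simps(8,9)[OF h, of c] C(1,3) unfolding inc_def by (metis nat_neq_iff subsetD)
  then show False using C by (auto simp: free_def)
qed

lemma hook_inc_free_right:
  assumes h: "hook S p q" and C: "C \<subseteq> S" "free inc (insert q C)" "c \<in> C"
  shows "snd q < snd c"
proof (rule ccontr)
  assume "\<not> ?thesis"
  then have "inc c q"
    using hook_simps(7,10)[OF h, of c] C(1,3) unfolding inc_def by (metis nat_neq_iff subsetD)
  then show False using C by (auto simp: free_def)
qed

text \<open>Two maximum \<open>r\<close>-free sets \<open>C\<close>, \<open>D\<close> are uncrossed into the maximal and the minimal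
  elements of \<open>C \<union> D\<close>. Counting with multiplicity, these are \<open>card C + card D\<close> elements, so
  both sets are again maximum and they share nothing but \<open>C \<inter> D\<close>.\<close>

lemma free_uncrossing:
  assumes fin: "finite S" and "C \<subseteq> S" "D \<subseteq> S" "free r C" "free r D"
    and card: "card C = width r S" "card D = width r S"
    and trans: "transp r"
  shows "free r {x \<in> C \<union> D. \<forall>y\<in>C \<union> D. \<not> r x y}"
    and "card {x \<in> C \<union> D. \<forall>y\<in>C \<union> D. \<not> r x y} = width r S"
    and "\<And>x. x \<in> C \<union> D \<Longrightarrow> \<forall>y\<in>C \<union> D. \<not> r x y \<Longrightarrow> \<forall>y\<in>C \<union> D. \<not> r y x \<Longrightarrow> x \<in> C \<inter> D"
proof -
  define U where "U = C \<union> D"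
  define M where "M = {x \<in> U. \<forall>y\<in>U. \<not> r x y}"
  define N where "N = {x \<in> U. \<forall>y\<in>U. \<not> r y x}"
  have finU: "finite C" "finite D" "finite U" "U \<subseteq> S" using assms finite_subset unfolding U_def by auto
  then have finMN: "finite M" "finite N" by (auto simp: M_def N_def)
  have MN: "free r M" "free r N" by (auto simp: M_def N_def free_def)
  have le: "card M \<le> width r S" "card N \<le> width r S"
    using MN finU(4) by (auto intro!: width_ge fin simp: M_def N_def)
  have "x \<in> M \<union> N" if "x \<in> U" for x
  proof (rule ccontr)
    assume "x \<notin> M \<union> N"
    then obtain y z where yz: "y \<in> U" "z \<in> U" "r x y" "r z x" using \<open>x \<in> U\<close> by (auto simp: M_def N_def)
    moreover have "r z y" using yz trans by (meson transpE)
    ultimately show False using assms(4,5) that unfolding U_def free_def by (metis Un_iff)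
  qed
  then have "U = M \<union> N" by (auto simp: M_def N_def)
  then have 1: "card U + card (M \<inter> N) = card M + card N" using card_Un_Int[OF finMN] by simp
  have 2: "card U + card (C \<inter> D) = card C + card D" using card_Un_Int finU(1,2) unfolding U_def by metis
  have sub: "C \<inter> D \<subseteq> M \<inter> N" using assms(4,5) by (auto simp: M_def N_def U_def free_def)
  then have 3: "card (C \<inter> D) \<le> card (M \<inter> N)" using finMN by (intro card_mono) auto
  have "card M = width r S" "card (M \<inter> N) = card (C \<inter> D)" using 1 2 3 le card by linarith+
  moreover from this have "C \<inter> D = M \<inter> N" using sub finMN by (metis card_subset_eq finite_Int)
  ultimately show "free r {x \<in> C \<union> D. \<forall>y\<in>C \<union> D. \<not> r x y}"
    "card {x \<in> C \<union> D. \<forall>y\<in>C \<union> D. \<not> r x y} = width r S"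
    "\<And>x. x \<in> C \<union> D \<Longrightarrow> \<forall>y\<in>C \<union> D. \<not> r x y \<Longrightarrow> \<forall>y\<in>C \<union> D. \<not> r y x \<Longrightarrow> x \<in> C \<inter> D"
    using MN by (auto simp: M_def N_def U_def)
qed

text \<open>The maximum sequence extended by \<open>p\<close> lies right of \<open>p\<close>, the
  one extended by \<open>q\<close> lies above \<open>q\<close>. Uncrossing the two yields a single
  maximum sequence with both properties, and this one is extended by \<open>p\<close> and
  \<open>q\<close> together.\<close>

lemma hook_inc_both_grow:
  assumes h: "hook S p q"
    and p: "width inc (insert p S) = Suc (width inc S)"
    and q: "width inc (insert q S) = Suc (width inc S)"
  shows "width inc (insert p (insert q S)) = Suc (Suc (width inc S))"
proof -
  note hs = hook_simps[OF h]
  from p obtain C where C: "C \<subseteq> S" "free inc (insert p C)" "card C = width inc S"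
    by (rule width_insert_grow[OF hs(1)])
  from q obtain D where D: "D \<subseteq> S" "free inc (insert q D)" "card D = width inc S"
    by (rule width_insert_grow[OF hs(1)])
  define M where "M = {x \<in> C \<union> D. \<forall>y\<in>C \<union> D. \<not> inc x y}"
  have "transp inc" by (auto simp: transp_def inc_def)
  note unc = free_uncrossing[OF hs(1) C(1) D(1) free_subset[OF C(2)] free_subset[OF D(2)] C(3) D(3) this]
  have M: "M \<subseteq> S" "free inc M" "card M = width inc S" "finite M"
    using unc(1,2) C(1) D(1) finite_subset[OF _ hs(1)] by (auto simp: M_def)
  have C_right: "fst p < fst c" if "c \<in> C" for c using hook_inc_free_top h C that by blast
  have D_above: "snd q < snd c" if "c \<in> D" for c using hook_inc_free_right h D that by blast
  \<comment> \<open>An element of \<open>M\<close> outside \<open>C \<inter> D\<close> dominates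
    some \<open>y\<close> of the other set by the third uncrossing fact. It inherits from
    \<open>y\<close> the inequality that its own set does not provide.\<close>
  have mid: "fst p < fst m \<and> snd q < snd m" if m: "m \<in> M" for m
  proof (rule ccontr)
    assume a: "\<not> ?thesis"
    have mCD: "m \<in> C \<union> D" "\<forall>y\<in>C \<union> D. \<not> inc m y" using m by (auto simp: M_def)
    have "m \<notin> C \<inter> D" using a C_right D_above by blast
    then obtain y where y: "y \<in> C \<union> D" "inc y m" using unc(3)[OF _ _ mCD] mCD by blast
    have "\<not> (y \<in> C \<and> m \<in> C)" "\<not> (y \<in> D \<and> m \<in> D)"
      using y C(2) D(2) by (auto simp: free_def)
    then consider "m \<in> C" "y \<in> D" | "m \<in> D" "y \<in> C" using mCD y by blast
    then show False
    proof cases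
      case 1
      then show False using a C_right[of m] D_above[of y] y(2) by (auto simp: inc_def)
    next
      case 2
      then show False using a C_right[of y] D_above[of m] y(2) by (auto simp: inc_def)
    qed
  qed
  have "\<not> inc m p" "\<not> inc m q" if "m \<in> M" for m
    using mid[OF that] by (auto simp: inc_def)
  moreover have "\<not> inc p q" "\<not> inc q p" "\<not> inc p p" "\<not> inc q q"
    using hook_inc_unrelated[OF h] by auto
  moreover have "\<not> inc p m" "\<not> inc q m" if "m \<in> M" for m
    using hook_inc_unrelated[OF h, of m] that M(1) by auto
  ultimately have "free inc (insert p (insert q M))"
    using M(2) by (simp add: free_insert)
  then have "card (insert p (insert q M)) \<le> width inc (insert p (insert q S))"
    using M(1) hs(1) by (intro width_ge) auto
  moreover have "card (insert p (insert q M)) = Suc (Suc (width inc S))"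
  proof -
    have "p \<notin> M" "q \<notin> M" using M(1) hs(2,3) by blast+
    then show ?thesis using M(3,4) hs(6) by simp
  qed
  moreover have "width inc (insert p (insert q S)) \<le> Suc (Suc (width inc S))"
    using width_insert_le[of "insert q S" inc p] q hs(1) by simp
  ultimately show ?thesis by simp
qed

text \<open>A sequence using both \<open>p\<close> and \<open>q\<close> is disjoint from every maximum free subset \<open>E\<close> of \<open>S\<close>:
  at a common element the two could be spliced into a longer one.\<close>

lemma hook_inc_no_grow:
  assumes h: "hook S p q"
    and p: "width inc (insert p S) = width inc S"
    and q: "width inc (insert q S) = width inc S"
    and pq: "width inc (insert p (insert q S)) = Suc (width inc S)"
  shows "2 * width inc S \<le> Suc (card S)"
proof -
  note hs = hook_simps[OF h]
  let ?L = "width inc S"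
  obtain F where F: "F \<subseteq> insert p (insert q S)" "free inc F" "card F = Suc ?L" "finite F"
    by (metis pq hs(1) finite_insert width_obtain)
  have "p \<in> F"
  proof (rule ccontr)
    assume "p \<notin> F"
    then have "card F \<le> width inc (insert q S)" using F hs(1) by (intro width_ge) auto
    then show False using q F by simp
  qed
  have "q \<in> F"
  proof (rule ccontr)
    assume "q \<notin> F"
    then have "card F \<le> width inc (insert p S)" using F hs(1) by (intro width_ge) auto
    then show False using p F by simp
  qed
  define M where "M = F - {p, q}"
  have M: "M \<subseteq> S" "finite M" "free inc (insert p (insert q M))"
    using F \<open>p \<in> F\<close> \<open>q \<in> F\<close> by (auto simp: M_def intro: free_subset)
  have cM: "Suc (card M) = ?L"
  proof -
    have "F = insert p (insert q M)" "p \<notin> insert q M" "q \<notin> M"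
      using \<open>p \<in> F\<close> \<open>q \<in> F\<close> hs(6) by (auto simp: M_def)
    then have "card F = Suc (Suc (card M))" using M(2) by simp
    then show ?thesis using F by simp
  qed
  obtain E where E: "E \<subseteq> S" "free inc E" "card E = ?L" "finite E"
    using hs(1) width_obtain by blast
  have "E \<inter> M = {}"
  proof (rule ccontr)
    assume "E \<inter> M \<noteq> {}"
    then obtain m where m: "m \<in> E" "m \<in> M" by blast
    have mp: "fst p < fst m" by (rule hook_inc_free_top[OF h M(1) _ m(2)]) (rule free_subset[OF M(3)], auto)
    have mq: "snd q < snd m" by (rule hook_inc_free_right[OF h M(1) _ m(2)]) (rule free_subset[OF M(3)], auto)
    have mS: "m \<in> S" using m E by blast
    have tri: "s = t \<or> inc s t \<or> inc t s \<or> dec s t \<or> dec t s" if "s \<in> S" "t \<in> S" for s t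
      using hook_trichotomy[OF h, of s t] that by blast
    have EM: "s = m \<or> dec s m \<or> dec m s" if "s \<in> E \<or> s \<in> M" for s
    proof -
      have "\<not> inc s m" "\<not> inc m s" using that m E(2) M(3) by (auto simp: free_def)
      then show ?thesis using tri[of s m] mS that E(1) M(1) by blast
    qed
    have freeM: "free inc M" by (rule free_subset[OF M(3)]) auto
    \<comment> \<open>Both \<open>E\<close> and \<open>M\<close> run from north-west to south-east
      through \<open>m\<close>. They are cut at \<open>m\<close>, which itself goes to the left
      halves, and the right halves are exchanged. Left halves stay above \<open>q\<close> and right
      halves stay to the right of \<open>p\<close>, which permits adding \<open>q\<close> to one
      spliced set and \<open>p\<close> to the other.\<close>
    define left where "left X = {s \<in> X. \<not> dec m s}" for X
    define right where "right X = {s \<in> X. dec m s}" for X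
    have lr: "card (left X) + card (right X) = card X" if "finite X" for X
    proof -
      have "X = left X \<union> right X" "left X \<inter> right X = {}" by (auto simp: left_def right_def)
      then show ?thesis by (metis card_Un_disjoint finite_Un that)
    qed
    have lft: "s = m \<or> dec s m" if "s \<in> left E \<or> s \<in> left M" for s
      using EM[of s] that by (auto simp: left_def)
    have cross: "\<not> inc s t \<and> \<not> inc t s" if "s \<in> left E \<or> s \<in> left M" "t \<in> right E \<or> t \<in> right M" for s t
      using lft[OF that(1)] that(2) by (auto simp: right_def dec_def inc_def)
    have sub: "left E \<subseteq> E" "right E \<subseteq> E" "left M \<subseteq> M" "right M \<subseteq> M"
      by (auto simp: left_def right_def)
    have 1: "card (left E) + card (right M) < ?L"
    proof -
      let ?X = "insert q (left E \<union> right M)"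
      have "\<not> inc s q" if "s \<in> left E" for s
        using lft[of s] that mq by (auto simp: inc_def dec_def)
      moreover have "\<not> inc s q" if "s \<in> right M" for s
        using that M(3) sub by (auto simp: free_def)
      moreover have "free inc (left E \<union> right M)"
        using cross free_subset[OF E(2)] free_subset[OF freeM] sub by (simp add: free_Un)
      moreover have "\<not> inc q s" if "s \<in> insert p (insert q S)" for s
        using hook_inc_unrelated[OF h that] by blast
      ultimately have "free inc ?X"
        using sub E(1) M(1) by (auto simp: free_insert)
      then have "card ?X \<le> width inc (insert q S)"
        using E(1) M(1) sub hs(1) by (intro width_ge) auto
      moreover have "left E \<inter> right M = {}"
        using lft by (fastforce simp: right_def dec_def)
      moreover have "q \<notin> left E \<union> right M" using hs(3) E(1) M(1) sub by blast
      moreover have "finite (left E)" "finite (right M)" using E(4) M(2) sub finite_subset by blast+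
      ultimately show ?thesis using q by (simp add: card_Un_disjoint)
    qed
    have 2: "card (left M) + card (right E) < ?L"
    proof -
      let ?X = "insert p (left M \<union> right E)"
      have "\<not> inc s p" if "s \<in> right E" for s
        using that mp by (auto simp: inc_def dec_def right_def)
      moreover have "\<not> inc s p" if "s \<in> left M" for s
        using that M(3) sub by (auto simp: free_def)
      moreover have "free inc (left M \<union> right E)"
        using cross free_subset[OF E(2)] free_subset[OF freeM] sub by (simp add: free_Un)
      moreover have "\<not> inc p s" if "s \<in> insert p (insert q S)" for s
        using hook_inc_unrelated[OF h that] by blast
      ultimately have "free inc ?X"
        using sub E(1) M(1) by (auto simp: free_insert)
      then have "card ?X \<le> width inc (insert p S)"
        using E(1) M(1) sub hs(1) by (intro width_ge) auto
      moreover have "left M \<inter> right E = {}"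
        using lft by (fastforce simp: right_def dec_def)
      moreover have "p \<notin> left M \<union> right E" using hs(2) E(1) M(1) sub by blast
      moreover have "finite (left M)" "finite (right E)" using E(4) M(2) sub finite_subset by blast+
      ultimately show ?thesis using p by (simp add: card_Un_disjoint)
    qed
    \<comment> \<open>The spliced sets have total size at most \<open>2 * ?L - 2\<close>, but
      \<open>card E + card M\<close> is \<open>2 * ?L - 1\<close>.\<close>
    show False using 1 2 lr[OF E(4)] lr[OF M(2)] cM E(3) by linarith
  qed
  then have "card E + card M = card (E \<union> M)" using E(4) M(2) by (simp add: card_Un_disjoint)
  also have "\<dots> \<le> card S" using E(1) M(1) hs(1) by (intro card_mono) auto
  finally show ?thesis using cM E(3) by simp
qed

section \<open>Local rules\<close>

text \<open>A label \<open>(L, c)\<close> stands for the two-row partition \<open>(L, c - L)\<close>, or for its conjugate.\<close>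

type_synonym label = "nat \<times> nat"

definition lab :: "('a \<Rightarrow> 'a \<Rightarrow> bool) \<Rightarrow> 'a set \<Rightarrow> label" where
  "lab r S = (width r S, card S)"

lemma width_insert_cases:
  assumes "finite S"
  shows "width r (insert p S) = width r S \<or> width r (insert p S) = Suc (width r S)"
  using width_insert_le[OF assms, of r p] width_mono[of "insert p S" S r] assms
  by (metis finite_insert le_SucE le_antisym subset_insertI)

text \<open>In terms of the parts \<open>fst v\<close> and \<open>snd v - fst v\<close>: the second
  part is nonnegative and at most the first.\<close>

definition valid :: "label \<Rightarrow> bool" where
  "valid v \<longleftrightarrow> fst v \<le> snd v \<and> snd v \<le> 2 * fst v"

text \<open>At most one box is added to the two-part partition, to either part.\<close>

definition step :: "label \<Rightarrow> label \<Rightarrow> bool" where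
  "step u v \<longleftrightarrow> v = u \<or> snd v = Suc (snd u) \<and> (fst v = fst u \<or> fst v = Suc (fst u))"

lemma valid_lab: "finite S \<Longrightarrow> no_three_chain r S \<Longrightarrow> valid (lab r S)"
  by (simp add: valid_def lab_def width_le_card card_le_twice_width)

lemma step_lab_insert:
  assumes "finite S"
  shows "step (lab r S) (lab r (insert p S))"
proof (cases "p \<in> S")
  case False
  then show ?thesis
    using assms width_insert_cases[OF assms, of r p]
    by (auto simp: step_def lab_def)
qed (auto simp: step_def insert_absorb)

text \<open>The inverse local rule: for a cell with north-west, south-east and north-east labels
  \<open>\<beta>\<close>, \<open>\<delta>\<close>, \<open>\<gamma>\<close> it computes the south-west label and whether the cell carries a dot.
  The parameter \<open>bk\<close> decides the only case that depends on the order relation, namely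
  \<open>\<beta> = \<delta> = (M, C)\<close> and \<open>\<gamma> = (N, C + 1)\<close>.\<close>

definition inv_rule :: "(nat \<Rightarrow> nat \<Rightarrow> nat \<Rightarrow> label \<times> bool) \<Rightarrow> label \<Rightarrow> label \<Rightarrow> label \<Rightarrow> label \<times> bool" where
  "inv_rule bk \<beta> \<delta> \<gamma> =
     (if snd \<gamma> = snd \<beta> then (\<delta>, False)
      else if snd \<gamma> = snd \<delta> then (\<beta>, False)
      else if fst \<beta> \<noteq> fst \<delta> then ((min (fst \<beta>) (fst \<delta>), snd \<beta> - 1), False)
      else bk (fst \<beta>) (snd \<beta>) (fst \<gamma>))"

text \<open>\<open>bk_dec\<close> undoes a step of row insertion, where a bumped box moves from the first to the
  second row; \<open>bk_inc\<close> is the same rule for conjugate partitions.\<close>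

definition bk_dec :: "nat \<Rightarrow> nat \<Rightarrow> nat \<Rightarrow> label \<times> bool" where
  "bk_dec M C N = (if N = M then ((M - 1, C - 1), False) else ((M, C), True))"

definition bk_inc :: "nat \<Rightarrow> nat \<Rightarrow> nat \<Rightarrow> label \<times> bool" where
  "bk_inc M C N =
     (if C = 0 \<or> C = M \<and> N = M then ((M, C), True)
      else if N = M \<or> C = 2 * M then ((M, C - 1), False)
      else ((M - 1, C - 1), False))"

text \<open>This interface collects all that the growth diagrams use of an order relation.
  \<open>dot_back\<close> and \<open>hook_back\<close> say that the backward rule reads actual
  placements correctly, which gives uniqueness. \<open>dot_avoid\<close> and
  \<open>hook_avoid\<close> say that obeying the rule creates no three-chain, and
  \<open>bk_inj\<close> that no information is lost; these give existence. The two swap assumptions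
  are for symmetry.\<close>

locale growth_rule =
  fixes r :: "nat \<times> nat \<Rightarrow> nat \<times> nat \<Rightarrow> bool"
    and bk :: "nat \<Rightarrow> nat \<Rightarrow> nat \<Rightarrow> label \<times> bool"
  assumes bk_valid: "\<And>M C N \<alpha> d. valid (M, C) \<Longrightarrow> valid (N, Suc C) \<Longrightarrow> N = M \<or> N = Suc M \<Longrightarrow>
      bk M C N = (\<alpha>, d) \<Longrightarrow>
      valid \<alpha> \<and> step \<alpha> (M, C) \<and> (if d then \<alpha> = (M, C) else Suc (snd \<alpha>) = C)"
    and bk_inj: "\<And>M C N N'. valid (M, C) \<Longrightarrow> valid (N, Suc C) \<Longrightarrow> valid (N', Suc C) \<Longrightarrow>
      N = M \<or> N = Suc M \<Longrightarrow> N' = M \<or> N' = Suc M \<Longrightarrow> bk M C N = bk M C N' \<Longrightarrow> N = N'"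
    and dot_back: "\<And>S e. finite S \<Longrightarrow> \<forall>s\<in>S. inc s e \<Longrightarrow> no_three_chain r (insert e S) \<Longrightarrow>
      bk (width r S) (card S) (width r (insert e S)) = (lab r S, True)"
    and dot_avoid: "\<And>S e N \<alpha>. finite S \<Longrightarrow> \<forall>s\<in>S. inc s e \<Longrightarrow> no_three_chain r S \<Longrightarrow>
      bk (width r S) (card S) N = (\<alpha>, True) \<Longrightarrow> no_three_chain r (insert e S)"
    and hook_back: "\<And>S p q. hook S p q \<Longrightarrow> no_three_chain r (insert p (insert q S)) \<Longrightarrow>
      width r (insert p S) = width r (insert q S) \<Longrightarrow>
      bk (width r (insert p S)) (Suc (card S)) (width r (insert p (insert q S))) = (lab r S, False)"
    and hook_avoid: "\<And>S p q N. hook S p q \<Longrightarrow> no_three_chain r (insert p S) \<Longrightarrow>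
      no_three_chain r (insert q S) \<Longrightarrow>
      width r (insert p S) \<noteq> width r (insert q S) \<or>
        bk (width r (insert p S)) (Suc (card S)) N = (lab r S, False) \<Longrightarrow>
      no_three_chain r (insert p (insert q S))"
    and free_swap: "\<And>C. free r C \<Longrightarrow> free r (prod.swap ` C)"
    and no_three_chain_swap: "\<And>S. no_three_chain r S \<Longrightarrow> no_three_chain r (prod.swap ` S)"

text \<open>A dot north-east of all others extends every increasing sequence.\<close>

lemma width_corner_dec:
  assumes "finite S" "\<forall>s\<in>S. inc s e"
  shows "width dec (insert e S) = Suc (width dec S)"
proof -
  obtain C where C: "C \<subseteq> S" "free dec C" "card C = width dec S" "finite C"
    using assms width_obtain by blast
  have ne: "e \<notin> S" using assms(2) by (auto simp: inc_def)
  have "\<not> dec e s \<and> \<not> dec s e" if "s \<in> S" for s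
    using assms(2) that by (auto simp: inc_def dec_def)
  then have "free dec (insert e C)" using C by (auto simp: free_insert dec_def)
  then have "card (insert e C) \<le> width dec (insert e S)"
    using C assms by (intro width_ge) auto
  moreover have "e \<notin> C" using ne C by blast
  ultimately show ?thesis using C(3,4) width_insert_le[OF assms(1), of dec e] by simp
qed

interpretation dec: growth_rule dec bk_dec
proof
  fix M C N \<alpha> d assume "valid (M, C)" "valid (N, Suc C)" "N = M \<or> N = Suc M" "bk_dec M C N = (\<alpha>, d)"
  then show "valid \<alpha> \<and> step \<alpha> (M, C) \<and> (if d then \<alpha> = (M, C) else Suc (snd \<alpha>) = C)"
    by (auto simp: valid_def step_def bk_dec_def split: if_splits)
next
  fix M C N N' assume "valid (M, C)" "valid (N, Suc C)" "valid (N', Suc C)"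
    "N = M \<or> N = Suc M" "N' = M \<or> N' = Suc M" "bk_dec M C N = bk_dec M C N'"
  then show "N = N'" by (auto simp: bk_dec_def)
next
  fix S :: "(nat \<times> nat) set" and e assume "finite S" "\<forall>s\<in>S. inc s e"
  then show "bk_dec (width dec S) (card S) (width dec (insert e S)) = (lab dec S, True)"
    by (simp add: width_corner_dec bk_dec_def lab_def)
next
  fix S :: "(nat \<times> nat) set" and e N \<alpha>
  assume e: "\<forall>s\<in>S. inc s e" and av: "no_three_chain dec S"
  have "\<not> dec e s \<and> \<not> dec s e" if "s \<in> insert e S" for s
    using e that by (auto simp: inc_def dec_def)
  then show "no_three_chain dec (insert e S)"
    using av unfolding no_three_chain_def by (metis insert_iff)
next
  fix S p q assume h: "hook S p q" and av: "no_three_chain dec (insert p (insert q S))"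
    and eq: "width dec (insert p S) = width dec (insert q S)"
  show "bk_dec (width dec (insert p S)) (Suc (card S)) (width dec (insert p (insert q S)))
      = (lab dec S, False)"
    using hook_dec_grow[OF h av] hook_dec_width[OF h] eq by (auto simp: bk_dec_def lab_def)
next
  fix S p q N assume h: "hook S p q" and avp: "no_three_chain dec (insert p S)"
    and avq: "no_three_chain dec (insert q S)"
    and w: "width dec (insert p S) \<noteq> width dec (insert q S) \<or>
        bk_dec (width dec (insert p S)) (Suc (card S)) N = (lab dec S, False)"
  note fin = hook_simps(1)[OF h]
  \<comment> \<open>\<open>bk_dec\<close> subtracts 1 from the width with truncation; positivity
    turns \<open>M - 1 = width dec S\<close> into genuine growth.\<close>
  have "width dec (insert p S) \<noteq> 0"
    using card_le_twice_width[OF _ avp] fin hook_simps(2)[OF h] by auto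
  then have "width dec (insert p S) = Suc (width dec S) \<or> width dec (insert q S) = Suc (width dec S)"
    using w width_insert_cases[OF fin, of dec p] width_insert_cases[OF fin, of dec q]
    by (auto simp: bk_dec_def lab_def split: if_splits)
  then show "no_three_chain dec (insert p (insert q S))"
    by (rule hook_dec_avoid[OF h avp avq])
next
  fix C assume "free dec C"
  then show "free dec (prod.swap ` C)" by (auto simp: free_def dec_def)
next
  fix S assume "no_three_chain dec S"
  then show "no_three_chain dec (prod.swap ` S)"
    unfolding no_three_chain_def ball_simps(9) by (auto simp: dec_def)
qed

interpretation inc: growth_rule inc bk_inc
proof
  fix M C N \<alpha> d assume "valid (M, C)" "valid (N, Suc C)" "N = M \<or> N = Suc M" "bk_inc M C N = (\<alpha>, d)"
  then show "valid \<alpha> \<and> step \<alpha> (M, C) \<and> (if d then \<alpha> = (M, C) else Suc (snd \<alpha>) = C)"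
    by (auto simp: valid_def step_def bk_inc_def split: if_splits)
next
  fix M C N N' assume "valid (M, C)" "valid (N, Suc C)" "valid (N', Suc C)"
    "N = M \<or> N = Suc M" "N' = M \<or> N' = Suc M" "bk_inc M C N = bk_inc M C N'"
  \<comment> \<open>The branch \<open>C = 2 * M\<close> does not look at \<open>N\<close>, but there
    \<open>N = M\<close> would violate \<open>valid\<close>, so \<open>N = Suc M\<close> is the only
    candidate.\<close>
  then show "N = N'" by (auto simp: bk_inc_def valid_def split: if_splits)
next
  fix S :: "(nat \<times> nat) set" and e
  assume fin: "finite S" and e: "\<forall>s\<in>S. inc s e" and av: "no_three_chain inc (insert e S)"
  have fr: "free inc S" using av e unfolding free_def no_three_chain_def by blast
  have ne: "e \<notin> S" using e by (auto simp: inc_def)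
  have wS: "width inc S = card S" using fr fin by (simp add: width_eq_card_if_free)
  \<comment> \<open>A dot north-east of everything forces \<open>S\<close> to be free, as otherwise
    it would complete a three-chain. Hence \<open>C = M\<close>, and the width stays put unless
    \<open>S\<close> is empty: this is the first branch of \<open>bk_inc\<close>.\<close>
  have "width inc (insert e S) = (if card S = 0 then 1 else card S)"
  proof (cases "S = {}")
    case True
    then show ?thesis using width_eq_card_if_free[of "{e}" inc] by (simp add: free_def inc_def)
  next
    case False
    then obtain s where s: "s \<in> S" by blast
    have "width inc (insert e S) \<noteq> card (insert e S)"
    proof
      assume "width inc (insert e S) = card (insert e S)"
      then have "free inc (insert e S)" using fin by (intro free_if_width_eq_card) auto
      then show False using s e unfolding free_def by blast
    qed
    then show ?thesis using False fin ne wS width_insert_cases[OF fin, of inc e] by auto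
  qed
  then show "bk_inc (width inc S) (card S) (width inc (insert e S)) = (lab inc S, True)"
    using wS by (simp add: bk_inc_def lab_def)
next
  fix S :: "(nat \<times> nat) set" and e N \<alpha>
  assume fin: "finite S" and e: "\<forall>s\<in>S. inc s e"
    and bk: "bk_inc (width inc S) (card S) N = (\<alpha>, True)"
  have "width inc S = card S"
    using bk width_le_card[OF fin, of inc] by (auto simp: bk_inc_def split: if_splits)
  then have fr: "free inc S" using fin by (intro free_if_width_eq_card)
  have "\<not> inc e s" if "s \<in> insert e S" for s
    using e that by (auto simp: inc_def)
  then show "no_three_chain inc (insert e S)"
    using fr unfolding no_three_chain_def free_def by (metis insert_iff)
next
  fix S p q assume h: "hook S p q" and av: "no_three_chain inc (insert p (insert q S))"
    and eq: "width inc (insert p S) = width inc (insert q S)"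
  note fin = hook_simps(1)[OF h]
  have c: "card S \<le> 2 * width inc S" "Suc (card S) \<le> 2 * width inc (insert p S)"
    using card_le_twice_width[of S inc] card_le_twice_width[of "insert p S" inc] fin
      no_three_chain_subset[OF av, of S] no_three_chain_subset[OF av, of "insert p S"]
      hook_simps(2)[OF h] by auto
  have wc: "width inc S \<le> card S" by (rule width_le_card[OF fin])
  show "bk_inc (width inc (insert p S)) (Suc (card S)) (width inc (insert p (insert q S)))
      = (lab inc S, False)"
  \<comment> \<open>Here \<open>M\<close> is the common width with \<open>p\<close> or with
    \<open>q\<close>, \<open>C = Suc (card S)\<close>, and \<open>N\<close> is the width with both.
    Without growth \<open>M < C\<close>, so the dot branch is excluded; either \<open>N = M\<close>,
    or \<open>hook_inc_no_grow\<close> and the bound \<open>C \<le> 2 * M\<close> give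
    \<open>C = 2 * M\<close>. With growth \<open>N = Suc M\<close>, while
    \<open>C \<le> 2 * M - 1\<close>. So the test \<open>C = 2 * M\<close> separates the two origins
    of \<open>N = Suc M\<close>.\<close>
  proof (cases "width inc (insert p S) = width inc S")
    case True
    then have "width inc (insert p (insert q S)) = width inc S \<or>
        width inc (insert p (insert q S)) = Suc (width inc S)"
      using width_insert_cases[of "insert q S" inc p] fin eq by auto
    then show ?thesis
      using hook_inc_no_grow[OF h] True eq c wc by (auto simp: bk_inc_def lab_def)
  next
    case False
    then have "width inc (insert p S) = Suc (width inc S)"
      using width_insert_cases[OF fin, of inc p] by auto
    then show ?thesis
      using hook_inc_both_grow[OF h] eq c by (auto simp: bk_inc_def lab_def)
  qed
next
  fix S p q assume "hook S p q" "no_three_chain inc (insert p S)" "no_three_chain inc (insert q S)"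
  then show "no_three_chain inc (insert p (insert q S))" by (rule hook_inc_avoid)
next
  fix C assume "free inc C"
  then show "free inc (prod.swap ` C)" by (auto simp: free_def inc_def)
next
  fix S assume "no_three_chain inc S"
  then show "no_three_chain inc (prod.swap ` S)"
    unfolding no_three_chain_def ball_simps(9) by (auto simp: inc_def)
qed

section \<open>Boundary labels of a shape\<close>

definition ferrers :: "(nat \<times> nat) set \<Rightarrow> bool" where
  "ferrers B \<longleftrightarrow> finite B \<and> (\<forall>x y. (x, y) \<in> B \<longrightarrow> 0 < x \<and> 0 < y)
     \<and> (\<forall>x y x' y'. (x, y) \<in> B \<longrightarrow> 0 < x' \<longrightarrow> x' \<le> x \<longrightarrow> 0 < y' \<longrightarrow> y' \<le> y \<longrightarrow> (x', y') \<in> B)"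

text \<open>The lattice points (north-east corners of boxes, or points on the axes) on the north-east
  boundary of \<open>B\<close>, including both axes beyond the shape.\<close>

definition boundary :: "(nat \<times> nat) set \<Rightarrow> (nat \<times> nat) set" where
  "boundary B = {(a, b). (a = 0 \<or> b = 0 \<or> (a, b) \<in> B) \<and> (Suc a, Suc b) \<notin> B}"

text \<open>The pair \<open>(a, b)\<close> is the south-west vertex of the corner box
  \<open>(Suc a, Suc b)\<close>, the vertex that enters the boundary when the box is
  removed.\<close>

definition corner :: "(nat \<times> nat) set \<Rightarrow> nat \<Rightarrow> nat \<Rightarrow> bool" where
  "corner B a b \<longleftrightarrow> (Suc a, Suc b) \<in> B \<and> (Suc (Suc a), Suc b) \<notin> B \<and> (Suc a, Suc (Suc b)) \<notin> B"

definition avoider :: "(nat \<times> nat \<Rightarrow> nat \<times> nat \<Rightarrow> bool) \<Rightarrow> (nat \<times> nat) set \<Rightarrow> (nat \<times> nat) set \<Rightarrow> bool" where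
  "avoider r B P \<longleftrightarrow> P \<subseteq> B \<and> partial_perm P \<and> (\<forall>(a, b)\<in>B. no_three_chain r (below P a b))"

text \<open>No order relation occurs in these conditions, so placements for \<open>inc\<close> and
  for \<open>dec\<close> are encoded by the same labellings.\<close>

definition good_labels :: "(nat \<times> nat) set \<Rightarrow> (nat \<Rightarrow> nat \<Rightarrow> label) \<Rightarrow> bool" where
  "good_labels B l \<longleftrightarrow> (\<forall>(a, b)\<in>boundary B.
     valid (l a b) \<and> (a = 0 \<or> b = 0 \<longrightarrow> l a b = (0, 0))
     \<and> ((Suc a, b) \<in> boundary B \<longrightarrow> step (l a b) (l (Suc a) b))
     \<and> ((a, Suc b) \<in> boundary B \<longrightarrow> step (l a b) (l a (Suc b))))"

lemma boundaryD: "(a, b) \<in> boundary B \<Longrightarrow> a = 0 \<or> b = 0 \<or> (a, b) \<in> B"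
  by (simp add: boundary_def)

lemma ferrersD:
  assumes "ferrers B" "(x, y) \<in> B"
  shows "0 < x" "0 < y" "0 < x' \<Longrightarrow> x' \<le> x \<Longrightarrow> 0 < y' \<Longrightarrow> y' \<le> y \<Longrightarrow> (x', y') \<in> B"
  using assms unfolding ferrers_def by blast+

lemma ferrers_remove_corner:
  assumes "ferrers B" "corner B a b"
  shows "ferrers (B - {(Suc a, Suc b)})"
  unfolding ferrers_def
proof (intro conjI allI impI)
  fix x y x' y' assume xy: "(x, y) \<in> B - {(Suc a, Suc b)}" "0 < x'" "x' \<le> x" "0 < y'" "y' \<le> y"
  then have "(x', y') \<in> B" using assms(1) ferrersD(3) by blast
  moreover have "(x', y') \<noteq> (Suc a, Suc b)"
  proof
    assume eq: "(x', y') = (Suc a, Suc b)"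
    then have "Suc (Suc a) \<le> x \<or> Suc (Suc b) \<le> y" using xy by auto
    then have "(Suc (Suc a), Suc b) \<in> B \<or> (Suc a, Suc (Suc b)) \<in> B"
      using ferrersD(3)[OF assms(1), of x y] xy eq by auto
    then show False using assms(2) by (simp add: corner_def)
  qed
  ultimately show "(x', y') \<in> B - {(Suc a, Suc b)}" by blast
qed (use assms in \<open>auto simp: ferrers_def\<close>)

lemma corner_exists:
  assumes "ferrers B" "B \<noteq> {}"
  obtains a b where "corner B a b"
proof -
  have fin: "finite B" using assms(1) by (simp add: ferrers_def)
  \<comment> \<open>A box with maximal coordinate sum has no box to its east or north.\<close>
  define m where "m = Max ((\<lambda>(x, y). x + y) ` B)"
  have "m \<in> (\<lambda>(x, y). x + y) ` B"
    unfolding m_def using fin assms(2) by (intro Max_in) auto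
  then obtain x y where xy: "(x, y) \<in> B" "m = x + y" by auto
  have le: "u + v \<le> m" if "(u, v) \<in> B" for u v
    unfolding m_def using fin that by (intro Max_ge) force+
  obtain a b where "x = Suc a" "y = Suc b"
    using ferrersD(1,2)[OF assms(1) xy(1)] by (metis gr0_implies_Suc)
  then have "corner B a b"
    using xy le[of "Suc x" y] le[of x "Suc y"] by (auto simp: corner_def)
  then show ?thesis by (rule that)
qed

lemma ferrers_induct [consumes 1, case_names empty corner]:
  assumes "ferrers B" "Q {}"
    and "\<And>B a b. ferrers B \<Longrightarrow> corner B a b \<Longrightarrow> Q (B - {(Suc a, Suc b)}) \<Longrightarrow> Q B"
  shows "Q B"
  using assms(1)
proof (induction "card B" arbitrary: B)
  case 0
  then show ?case using assms(2) by (simp add: ferrers_def)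
next
  case (Suc n)
  then have "B \<noteq> {}" by auto
  then obtain a b where c: "corner B a b" using corner_exists Suc.prems by blast
  then have "n = card (B - {(Suc a, Suc b)})" using Suc.hyps by (simp add: corner_def)
  then show ?case
    using Suc.hyps(1) assms(3) c ferrers_remove_corner Suc.prems by blast
qed

lemma boundary_remove_corner:
  assumes "ferrers B" "corner B a b"
  shows "boundary (B - {(Suc a, Suc b)}) = insert (a, b) (boundary B - {(Suc a, Suc b)})"
proof -
  have "a = 0 \<or> b = 0 \<or> (a, b) \<in> B"
    using assms ferrersD(3)[OF assms(1), of "Suc a" "Suc b" a b] by (auto simp: corner_def)
  then show ?thesis using assms(2) by (auto simp: boundary_def corner_def)
qed

lemma boundary_corner:
  assumes "ferrers B" "corner B a b"
  shows "(Suc a, Suc b) \<in> boundary B" "(a, Suc b) \<in> boundary B" "(Suc a, b) \<in> boundary B"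
    "(a, b) \<notin> boundary B"
proof -
  note F = ferrersD(3)[OF assms(1)]
  have "(Suc (Suc a), Suc (Suc b)) \<notin> B" using F assms(2) unfolding corner_def by force
  then show "(Suc a, Suc b) \<in> boundary B" using assms(2) by (auto simp: boundary_def corner_def)
  show "(a, Suc b) \<in> boundary B" "(Suc a, b) \<in> boundary B" "(a, b) \<notin> boundary B"
    using F[of "Suc a" "Suc b" a "Suc b"] F[of "Suc a" "Suc b" "Suc a" b] assms(2)
    by (auto simp: boundary_def corner_def)
qed

section \<open>Dots south-west of the four vertices of a cell\<close>

lemma finite_below: "finite P \<Longrightarrow> finite (below P a b)"
  by (simp add: below_def)

lemma below_remove_corner:
  assumes "ferrers B" "corner B a b" "u = 0 \<or> v = 0 \<or> (u, v) \<in> B - {(Suc a, Suc b)}"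
  shows "below (P - {(Suc a, Suc b)}) u v = below P u v"
proof -
  have "\<not> (Suc a \<le> u \<and> Suc b \<le> v)"
  proof
    assume *: "Suc a \<le> u \<and> Suc b \<le> v"
    then have "(u, v) \<in> B - {(Suc a, Suc b)}" using assms(3) by auto
    then have "(Suc a, Suc b) \<in> B - {(Suc a, Suc b)}"
      using * ferrersD(3)[OF ferrers_remove_corner[OF assms(1,2)]] by blast
    then show False by blast
  qed
  then show ?thesis by (auto simp: below_def)
qed

lemma below_axis:
  assumes "ferrers B" "P \<subseteq> B" "a = 0 \<or> b = 0"
  shows "below P a b = {}"
  using assms ferrersD(1,2)[OF assms(1)] by (fastforce simp: below_def)

lemma avoider_below:
  assumes "ferrers B" "avoider r B P" "a = 0 \<or> b = 0 \<or> (a, b) \<in> B"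
  shows "no_three_chain r (below P a b)" "finite (below P a b)"
proof -
  show "no_three_chain r (below P a b)"
  proof (cases "a = 0 \<or> b = 0")
    case True
    have "P \<subseteq> B" using assms(2) by (simp add: avoider_def)
    from below_axis[OF assms(1) this True] have "below P a b = {}" .
    then show ?thesis by (simp add: no_three_chain_def)
  qed (use assms in \<open>auto simp: avoider_def\<close>)
  show "finite (below P a b)"
    using assms finite_subset by (auto intro!: finite_below simp: avoider_def ferrers_def)
qed

lemma below_Suc_col: "below P (Suc a) b = below P a b \<union> {x \<in> P. fst x = Suc a \<and> snd x \<le> b}"
  unfolding below_def by fastforce

lemma below_Suc_row: "below P a (Suc b) = below P a b \<union> {x \<in> P. snd x = Suc b \<and> fst x \<le> a}"
  unfolding below_def by fastforce

lemma below_Suc_left: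
  assumes "partial_perm P"
  obtains "below P (Suc a) b = below P a b"
  | p where "p \<in> P" "fst p = Suc a" "snd p \<le> b" "below P (Suc a) b = insert p (below P a b)"
proof (cases "\<exists>p\<in>P. fst p = Suc a \<and> snd p \<le> b")
  case True
  then obtain p where p: "p \<in> P" "fst p = Suc a" "snd p \<le> b" by blast
  have "x = p" if "x \<in> P" "fst x = Suc a" for x
    using assms p that unfolding partial_perm_def by (metis inj_onD)
  then have "{x \<in> P. fst x = Suc a \<and> snd x \<le> b} = {p}" using p by blast
  then have "below P (Suc a) b = insert p (below P a b)" by (simp add: below_Suc_col)
  then show ?thesis using that(2) p by blast
next
  case False
  then have "below P (Suc a) b = below P a b" unfolding below_Suc_col by blast
  then show ?thesis by (rule that(1))
qed

lemma below_Suc_right: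
  assumes "partial_perm P"
  obtains "below P a (Suc b) = below P a b"
  | p where "p \<in> P" "snd p = Suc b" "fst p \<le> a" "below P a (Suc b) = insert p (below P a b)"
proof (cases "\<exists>p\<in>P. snd p = Suc b \<and> fst p \<le> a")
  case True
  then obtain p where p: "p \<in> P" "snd p = Suc b" "fst p \<le> a" by blast
  have "x = p" if "x \<in> P" "snd x = Suc b" for x
    using assms p that unfolding partial_perm_def by (metis inj_onD)
  then have "{x \<in> P. snd x = Suc b \<and> fst x \<le> a} = {p}" using p by blast
  then have "below P a (Suc b) = insert p (below P a b)" by (simp add: below_Suc_row)
  then show ?thesis using that(2) p by blast
next
  case False
  then have "below P a (Suc b) = below P a b" unfolding below_Suc_row by blast
  then show ?thesis by (rule that(1))
qed

text \<open>Row \<open>Suc b\<close> and column \<open>Suc a\<close> contribute at most one dot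
  each, and a dot in the cell itself is the only contribution of both. The case \<open>both\<close>
  is the hook situation.\<close>

lemma cell_cases:
  assumes "partial_perm P" "finite P"
  obtains (dot) "(Suc a, Suc b) \<in> P" "below P a (Suc b) = below P a b"
      "below P (Suc a) b = below P a b"
      "below P (Suc a) (Suc b) = insert (Suc a, Suc b) (below P a b)"
      "\<forall>s\<in>below P a b. inc s (Suc a, Suc b)"
  | (none) "(Suc a, Suc b) \<notin> P" "below P a (Suc b) = below P a b"
      "below P (Suc a) b = below P a b" "below P (Suc a) (Suc b) = below P a b"
  | (row) p where "(Suc a, Suc b) \<notin> P" "p \<notin> below P a b"
      "below P a (Suc b) = insert p (below P a b)" "below P (Suc a) b = below P a b"
      "below P (Suc a) (Suc b) = insert p (below P a b)"
  | (col) q where "(Suc a, Suc b) \<notin> P" "q \<notin> below P a b"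
      "below P a (Suc b) = below P a b" "below P (Suc a) b = insert q (below P a b)"
      "below P (Suc a) (Suc b) = insert q (below P a b)"
  | (both) p q where "(Suc a, Suc b) \<notin> P" "hook (below P a b) p q"
      "below P a (Suc b) = insert p (below P a b)" "below P (Suc a) b = insert q (below P a b)"
      "below P (Suc a) (Suc b) = insert p (insert q (below P a b))"
proof (cases "(Suc a, Suc b) \<in> P")
  case True
  have c: "x = (Suc a, Suc b)" if "x \<in> P" "fst x = Suc a \<or> snd x = Suc b" for x
    using assms(1) True that unfolding partial_perm_def by (metis fst_conv snd_conv inj_onD)
  have "\<not> (x \<in> P \<and> fst x = Suc a \<and> snd x \<le> b)" "\<not> (x \<in> P \<and> snd x = Suc b \<and> fst x \<le> a)"
    "x \<in> P \<and> fst x = Suc a \<and> snd x \<le> Suc b \<longleftrightarrow> x = (Suc a, Suc b)" for x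
    using c[of x] True by auto
  note c' = this
  have "{x \<in> P. fst x = Suc a \<and> snd x \<le> b} = {}" "{x \<in> P. snd x = Suc b \<and> fst x \<le> a} = {}"
    using c'(1,2) by blast+
  then have "below P a (Suc b) = below P a b" "below P (Suc a) b = below P a b"
    unfolding below_Suc_col below_Suc_row by blast+
  moreover have "{x \<in> P. fst x = Suc a \<and> snd x \<le> Suc b} = {(Suc a, Suc b)}"
    using c'(3) by blast
  ultimately have "below P a (Suc b) = below P a b" "below P (Suc a) b = below P a b"
    "below P (Suc a) (Suc b) = insert (Suc a, Suc b) (below P a b)"
    by (simp_all add: below_Suc_col[of P a "Suc b"])
  then show ?thesis using True by (intro dot) (auto simp: below_def inc_def)
next
  case False
  have ge: "below P (Suc a) (Suc b) = below P a (Suc b) \<union> below P (Suc a) b"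
  proof -
    have "{x \<in> P. fst x = Suc a \<and> snd x \<le> Suc b} = {x \<in> P. fst x = Suc a \<and> snd x \<le> b}"
      using False by (auto simp: le_Suc_eq prod_eq_iff)
    then show ?thesis
      by (simp add: below_Suc_col[of P a] below_Suc_row[of P a] Un_ac)
  qed
  show ?thesis
  proof (rule below_Suc_left[OF assms(1), of a b])
    assume d: "below P (Suc a) b = below P a b"
    show thesis
    proof (rule below_Suc_right[OF assms(1), of a b])
      assume "below P a (Suc b) = below P a b"
      then show thesis using none False d ge by auto
    next
      fix p assume p: "p \<in> P" "snd p = Suc b" "fst p \<le> a" "below P a (Suc b) = insert p (below P a b)"
      then have "p \<notin> below P a b" by (auto simp: below_def)
      moreover have "below P (Suc a) (Suc b) = insert p (below P a b)" using ge d p by auto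
      ultimately show thesis using row[of p] False d p by blast
    qed
  next
    fix q assume q: "q \<in> P" "fst q = Suc a" "snd q \<le> b" "below P (Suc a) b = insert q (below P a b)"
    then have qn: "q \<notin> below P a b" by (auto simp: below_def)
    show thesis
    proof (rule below_Suc_right[OF assms(1), of a b])
      assume "below P a (Suc b) = below P a b"
      then show thesis using col[of q] False q qn ge by auto
    next
      fix p assume p: "p \<in> P" "snd p = Suc b" "fst p \<le> a" "below P a (Suc b) = insert p (below P a b)"
      then have pn: "p \<notin> below P a b" by (auto simp: below_def)
      have "insert p (insert q (below P a b)) \<subseteq> P" using p q by (auto simp: below_def)
      then have "partial_perm (insert p (insert q (below P a b)))"
        using assms(1) unfolding partial_perm_def by (meson inj_on_subset)
      then have "hook (below P a b) p q"
        using p q pn qn finite_below[OF assms(2)] unfolding hook_def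
        by (auto simp: dec_def below_def)
      moreover have "below P (Suc a) (Suc b) = insert p (insert q (below P a b))" using ge p q by auto
      ultimately show thesis using both[of p q] False p q by blast
    qed
  qed
qed

section \<open>Boundary labels determine placements, and all good labels occur\<close>

context growth_rule
begin

text \<open>If the row or the column brings no new dot, the counts reveal it. A dot in the cell is
  handled by \<open>dot_back\<close>. In a hook with different widths exactly one of
  \<open>p\<close>, \<open>q\<close> enlarges the width, so the old width is the minimum; equal
  widths are left to \<open>hook_back\<close>.\<close>

lemma inv_rule_below:
  assumes "partial_perm P" "finite P" and av: "no_three_chain r (below P (Suc a) (Suc b))"
  shows "inv_rule bk (lab r (below P a (Suc b))) (lab r (below P (Suc a) b))
      (lab r (below P (Suc a) (Suc b))) = (lab r (below P a b), (Suc a, Suc b) \<in> P)"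
proof -
  define S where "S = below P a b"
  have fin: "finite S" unfolding S_def using assms(2) by (rule finite_below)
  show ?thesis
  proof (rule cell_cases[OF assms(1,2), of a b])
    assume c: "(Suc a, Suc b) \<in> P" "below P a (Suc b) = below P a b"
      "below P (Suc a) b = below P a b"
      "below P (Suc a) (Suc b) = insert (Suc a, Suc b) (below P a b)"
      "\<forall>s\<in>below P a b. inc s (Suc a, Suc b)"
    then have "(Suc a, Suc b) \<notin> S" by (auto simp: S_def inc_def)
    then show ?thesis
      using dot_back[OF fin, of "(Suc a, Suc b)"] c av fin
      by (simp add: inv_rule_def lab_def flip: S_def)
  next
    fix p q assume c: "(Suc a, Suc b) \<notin> P" "hook (below P a b) p q"
      "below P a (Suc b) = insert p (below P a b)" "below P (Suc a) b = insert q (below P a b)"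
      "below P (Suc a) (Suc b) = insert p (insert q (below P a b))"
    note c' = c[folded S_def]
    note hs = hook_simps[OF c'(2)]
    have "card (insert p (insert q S)) = Suc (Suc (card S))" using hs by simp
    moreover have "card (insert p S) = Suc (card S)" "card (insert q S) = Suc (card S)" using hs by auto
    ultimately show ?thesis
      using hook_back[OF c'(2)] av c' width_insert_cases[OF fin, of r p] width_insert_cases[OF fin, of r q]
      by (auto simp: inv_rule_def lab_def simp flip: S_def)
  qed (use fin in \<open>auto simp: inv_rule_def lab_def simp flip: S_def\<close>)
qed

text \<open>The last conjunct is inclusion-exclusion for the dot counts at the four vertices; it
  later shows when the cell may carry a dot.\<close>

lemma inv_rule_valid:
  assumes "valid \<beta>" "valid \<delta>" "valid \<gamma>" "step \<beta> \<gamma>" "step \<delta> \<gamma>" and eq: "inv_rule bk \<beta> \<delta> \<gamma> = (\<alpha>, d)"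
  shows "valid \<alpha> \<and> step \<alpha> \<beta> \<and> step \<alpha> \<delta> \<and> snd \<gamma> + snd \<alpha> = snd \<beta> + snd \<delta> + (if d then 1 else 0)"
proof (cases "snd \<gamma> = snd \<beta> \<or> snd \<gamma> = snd \<delta> \<or> fst \<beta> \<noteq> fst \<delta>")
  case True
  then show ?thesis using assms
    by (cases \<alpha>; cases \<beta>; cases \<gamma>; cases \<delta>)
      (auto simp: inv_rule_def valid_def step_def split: if_splits)
next
  case False
  obtain M C where \<beta>: "\<beta> = (M, C)" by fastforce
  have \<delta>: "\<delta> = (M, C)" using False assms(4,5) \<beta> by (cases \<delta>) (auto simp: step_def)
  obtain N where \<gamma>: "\<gamma> = (N, Suc C)" "N = M \<or> N = Suc M"
    using False assms(4) \<beta> by (cases \<gamma>) (auto simp: step_def)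
  have "bk M C N = (\<alpha>, d)" using eq by (simp add: \<beta> \<delta> \<gamma> inv_rule_def)
  from bk_valid[OF _ _ \<gamma>(2) this] assms(1,3) show ?thesis
    by (auto simp: \<beta> \<delta> \<gamma> split: if_splits)
qed

text \<open>The count identity fixes the count of \<open>\<gamma>\<close>. Outside the
  \<open>bk\<close> case the two steps into \<open>\<gamma>\<close> leave a single width: that of
  \<open>\<beta>\<close> or \<open>\<delta>\<close> if the count is unchanged, and the larger of two
  different widths otherwise. In the \<open>bk\<close> case \<open>bk_inj\<close> decides.\<close>

lemma inv_rule_inj:
  assumes v: "valid \<beta>" "valid \<delta>" "valid \<gamma>" "valid \<gamma>'" and s: "step \<beta> \<gamma>" "step \<delta> \<gamma>" "step \<beta> \<gamma>'" "step \<delta> \<gamma>'"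
    and eq: "inv_rule bk \<beta> \<delta> \<gamma> = inv_rule bk \<beta> \<delta> \<gamma>'"
  shows "\<gamma> = \<gamma>'"
proof -
  obtain \<alpha> d where a: "inv_rule bk \<beta> \<delta> \<gamma> = (\<alpha>, d)" by fastforce
  have snd: "snd \<gamma> = snd \<gamma>'"
    using inv_rule_valid[OF v(1,2,3) s(1,2) a] inv_rule_valid[OF v(1,2,4) s(3,4) a[unfolded eq]] by simp
  show ?thesis
  proof (cases "snd \<gamma> = snd \<beta> \<or> snd \<gamma> = snd \<delta> \<or> fst \<beta> \<noteq> fst \<delta>")
    case True
    then show ?thesis using s snd
      by (cases \<beta>; cases \<gamma>; cases \<gamma>'; cases \<delta>) (auto simp: step_def)
  next
    case False
    obtain M C where \<beta>: "\<beta> = (M, C)" by fastforce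
    have \<delta>: "\<delta> = (M, C)" using False s \<beta> by (cases \<delta>) (auto simp: step_def)
    obtain N where \<gamma>: "\<gamma> = (N, Suc C)" "N = M \<or> N = Suc M"
      using False s \<beta> by (cases \<gamma>) (auto simp: step_def)
    obtain N' where \<gamma>': "\<gamma>' = (N', Suc C)" "N' = M \<or> N' = Suc M"
      using False s snd \<beta> by (cases \<gamma>') (auto simp: step_def)
    have "bk M C N = bk M C N'" using eq by (simp add: \<beta> \<delta> \<gamma> \<gamma>' inv_rule_def)
    from bk_inj[OF _ _ _ \<gamma>(2) \<gamma>'(2) this] v show ?thesis by (simp add: \<beta> \<gamma> \<gamma>')
  qed
qed

lemma avoider_remove_corner:
  assumes "ferrers B" "corner B a b" "avoider r B P"
  shows "avoider r (B - {(Suc a, Suc b)}) (P - {(Suc a, Suc b)})"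
  unfolding avoider_def
proof (intro conjI)
  show "P - {(Suc a, Suc b)} \<subseteq> B - {(Suc a, Suc b)}" "partial_perm (P - {(Suc a, Suc b)})"
    using assms(3) by (auto simp: avoider_def partial_perm_def intro: inj_on_diff)
  show "\<forall>(u, v)\<in>B - {(Suc a, Suc b)}. no_three_chain r (below (P - {(Suc a, Suc b)}) u v)"
  proof (rule ballI)
    fix w assume "w \<in> B - {(Suc a, Suc b)}"
    moreover obtain u v where w: "w = (u, v)" by fastforce
    ultimately have uv: "(u, v) \<in> B" "(u, v) \<noteq> (Suc a, Suc b)" by auto
    then have "below (P - {(Suc a, Suc b)}) u v = below P u v"
      by (intro below_remove_corner[OF assms(1,2)]) blast
    then show "case w of (u, v) \<Rightarrow> no_three_chain r (below (P - {(Suc a, Suc b)}) u v)"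
      using avoider_below(1)[OF assms(1,3)] uv w by simp
  qed
qed

lemma good_labels_avoider:
  assumes "ferrers B" "avoider r B P"
  shows "good_labels B (\<lambda>a b. lab r (below P a b))"
  unfolding good_labels_def
proof clarify
  fix a b assume ab: "(a, b) \<in> boundary B"
  note av = avoider_below[OF assms, of a b]
  have pp: "partial_perm P" "P \<subseteq> B" using assms(2) by (auto simp: avoider_def)
  have fin: "finite (below P a b)" using av ab by (auto simp: boundary_def)
  have "valid (lab r (below P a b))" using av ab by (auto simp: boundary_def intro: valid_lab)
  moreover have "lab r (below P a b) = (0, 0)" if "a = 0 \<or> b = 0"
    using below_axis[OF assms(1) pp(2) that] width_le_card[of "{}" r] by (auto simp: lab_def)
  moreover have "step (lab r (below P a b)) (lab r (below P (Suc a) b))"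
    by (rule below_Suc_left[OF pp(1), of a b])
      (use step_lab_insert[OF fin] in \<open>auto simp: step_def\<close>)
  moreover have "step (lab r (below P a b)) (lab r (below P a (Suc b)))"
    by (rule below_Suc_right[OF pp(1), of a b])
      (use step_lab_insert[OF fin] in \<open>auto simp: step_def\<close>)
  ultimately show "valid (lab r (below P a b)) \<and>
       (a = 0 \<or> b = 0 \<longrightarrow> lab r (below P a b) = (0, 0)) \<and>
       ((Suc a, b) \<in> boundary B \<longrightarrow> step (lab r (below P a b)) (lab r (below P (Suc a) b))) \<and>
       ((a, Suc b) \<in> boundary B \<longrightarrow> step (lab r (below P a b)) (lab r (below P a (Suc b))))"
    by blast
qed

lemma avoider_unique:
  assumes "ferrers B" "avoider r B P" "avoider r B Q"
    and "\<And>a b. (a, b) \<in> boundary B \<Longrightarrow> lab r (below P a b) = lab r (below Q a b)"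
  shows "P = Q"
  using assms
proof (induction B arbitrary: P Q rule: ferrers_induct)
  case empty
  then show ?case by (simp add: avoider_def)
next
  case (corner B a b)
  let ?e = "(Suc a, Suc b)"
  let ?B = "B - {?e}"
  have fin: "finite P" "finite Q" and pp: "partial_perm P" "partial_perm Q"
    using corner.prems(1,2) corner.hyps(1) finite_subset by (auto simp: avoider_def ferrers_def)
  have eB: "?e \<in> B" using corner.hyps(2) by (simp add: corner_def)
  note bc = boundary_corner[OF corner.hyps(1,2)]
  have "(lab r (below P a b), ?e \<in> P) = (lab r (below Q a b), ?e \<in> Q)"
    using inv_rule_below[OF pp(1) fin(1), of a b] inv_rule_below[OF pp(2) fin(2), of a b]
      corner.prems bc eB avoider_below(1)[OF corner.hyps(1)] by metis
  then have ab: "lab r (below P a b) = lab r (below Q a b)" "?e \<in> P \<longleftrightarrow> ?e \<in> Q" by simp_all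
  have "P - {?e} = Q - {?e}"
  proof (rule corner.IH)
    show "avoider r ?B (P - {?e})" "avoider r ?B (Q - {?e})"
      using avoider_remove_corner corner.hyps corner.prems by auto
    fix u v assume uv: "(u, v) \<in> boundary ?B"
    then have "below (P - {?e}) u v = below P u v" "below (Q - {?e}) u v = below Q u v"
      using below_remove_corner[OF corner.hyps(1,2), of u v] by (auto simp: boundary_def)
    moreover have "(u, v) = (a, b) \<or> (u, v) \<in> boundary B"
      using uv boundary_remove_corner[OF corner.hyps(1,2)] by blast
    ultimately show "lab r (below (P - {?e}) u v) = lab r (below (Q - {?e}) u v)"
      using ab corner.prems(3) by auto
  qed
  then show ?case using ab(2) by blast
qed

lemma good_labels_remove_corner:
  assumes "ferrers B" "corner B a b" "good_labels B l"
    and "inv_rule bk (l a (Suc b)) (l (Suc a) b) (l (Suc a) (Suc b)) = (\<alpha>, d)"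
  shows "good_labels (B - {(Suc a, Suc b)}) (\<lambda>u v. if (u, v) = (a, b) then \<alpha> else l u v)"
    (is "good_labels ?B ?l")
proof -
  note bc = boundary_corner[OF assms(1,2)]
  note br = boundary_remove_corner[OF assms(1,2)]
  have g: "valid (l u v)" "u = 0 \<or> v = 0 \<Longrightarrow> l u v = (0, 0)"
    "(Suc u, v) \<in> boundary B \<Longrightarrow> step (l u v) (l (Suc u) v)"
    "(u, Suc v) \<in> boundary B \<Longrightarrow> step (l u v) (l u (Suc v))" if "(u, v) \<in> boundary B" for u v
    using assms(3) that unfolding good_labels_def by blast+
  have \<alpha>: "valid \<alpha>" "step \<alpha> (l a (Suc b))" "step \<alpha> (l (Suc a) b)"
    using inv_rule_valid[OF _ _ _ _ _ assms(4)] g bc by blast+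
  have \<alpha>0: "\<alpha> = (0, 0)" if "a = 0 \<or> b = 0"
    using g(2)[OF bc(2)] g(2)[OF bc(3)] \<alpha> that by (auto simp: step_def prod_eq_iff)
  \<comment> \<open>The points just west and just south of \<open>(a, b)\<close> are interior,
    because the boxes west and south of the removed corner remain. So the new label only has to fit
    the labels north and east of it.\<close>
  have left: "(u, b) \<notin> boundary ?B" if "Suc u = a" for u
    using that ferrersD(3)[OF assms(1), of "Suc a" "Suc b" "Suc u" "Suc b"] assms(2)
    by (auto simp: boundary_def corner_def)
  have down: "(a, v) \<notin> boundary ?B" if "Suc v = b" for v
    using that ferrersD(3)[OF assms(1), of "Suc a" "Suc b" "Suc a" "Suc v"] assms(2)
    by (auto simp: boundary_def corner_def)
  show ?thesis
    unfolding good_labels_def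
  proof clarify
    fix u v assume uv: "(u, v) \<in> boundary ?B"
    show "valid (?l u v) \<and> (u = 0 \<or> v = 0 \<longrightarrow> ?l u v = (0, 0)) \<and>
       ((Suc u, v) \<in> boundary ?B \<longrightarrow> step (?l u v) (?l (Suc u) v)) \<and>
       ((u, Suc v) \<in> boundary ?B \<longrightarrow> step (?l u v) (?l u (Suc v)))"
    proof (cases "(u, v) = (a, b)")
      case True
      then show ?thesis using \<alpha> \<alpha>0 by auto
    next
      case False
      then have uvB: "(u, v) \<in> boundary B" using uv br by blast
      have "\<not> (Suc u = a \<and> v = b)" "\<not> (u = a \<and> Suc v = b)" using left down uv by auto
      note n = this
      have eqs: "?l u v = l u v" "?l (Suc u) v = l (Suc u) v" "?l u (Suc v) = l u (Suc v)"
        using False n by auto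
      have "(Suc u, v) \<in> boundary B" if "(Suc u, v) \<in> boundary ?B"
        using that n(1) by (auto simp: br)
      moreover have "(u, Suc v) \<in> boundary B" if "(u, Suc v) \<in> boundary ?B"
        using that n(2) by (auto simp: br)
      ultimately show ?thesis unfolding eqs using g[OF uvB] by blast
    qed
  qed
qed

text \<open>The inverse rule prescribes the label of the uncovered vertex and whether the removed
  box gets a dot. The smaller shape then supplies \<open>P\<close>, and \<open>Q\<close> adds the
  dot if required. That the label at the corner comes out as \<open>?\<gamma>\<close> follows from
  \<open>inv_rule_inj\<close>.\<close>

lemma avoider_exists:
  assumes "ferrers B" "good_labels B l"
  shows "\<exists>P. avoider r B P \<and> (\<forall>(a, b)\<in>boundary B. lab r (below P a b) = l a b)"
  using assms
proof (induction B arbitrary: l rule: ferrers_induct)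
  case empty
  have "avoider r {} {}" by (simp add: avoider_def partial_perm_def)
  moreover have "lab r (below {} a b) = l a b" if "(a, b) \<in> boundary {}" for a b
    using that empty width_le_card[of "{}" r] by (fastforce simp: good_labels_def boundary_def lab_def below_def)
  ultimately show ?case by blast
next
  case (corner B a b)
  let ?e = "(Suc a, Suc b)"
  let ?B = "B - {?e}"
  let ?\<beta> = "l a (Suc b)" and ?\<delta> = "l (Suc a) b" and ?\<gamma> = "l (Suc a) (Suc b)"
  note F = corner.hyps(1,2)
  note F' = ferrers_remove_corner[OF F]
  note bc = boundary_corner[OF F]
  note br = boundary_remove_corner[OF F]
  obtain \<alpha> d where \<alpha>: "inv_rule bk ?\<beta> ?\<delta> ?\<gamma> = (\<alpha>, d)" by fastforce
  have g: "valid ?\<beta>" "valid ?\<delta>" "valid ?\<gamma>" "step ?\<beta> ?\<gamma>" "step ?\<delta> ?\<gamma>"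
    using corner.prems bc unfolding good_labels_def by blast+
  note iv = inv_rule_valid[OF g \<alpha>]
  obtain P where P: "avoider r ?B P"
    and lP: "\<And>u v. (u, v) \<in> boundary ?B \<Longrightarrow> lab r (below P u v) = (if (u, v) = (a, b) then \<alpha> else l u v)"
    using corner.IH[OF good_labels_remove_corner[OF F corner.prems \<alpha>]] by blast
  have lab\<alpha>: "lab r (below P a b) = \<alpha>" "lab r (below P a (Suc b)) = ?\<beta>" "lab r (below P (Suc a) b) = ?\<delta>"
    using lP[of a b] lP[of a "Suc b"] lP[of "Suc a" b] bc by (simp_all add: br)
  have PB: "P \<subseteq> ?B" "partial_perm P" using P by (simp_all add: avoider_def)
  then have fin: "finite P" using F' finite_subset unfolding ferrers_def by blast
  have eP: "?e \<notin> P" using PB by blast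
  have eB: "?e \<in> B" using F(2) by (simp add: corner_def)
  have av: "no_three_chain r (below P a (Suc b))" "no_three_chain r (below P (Suc a) b)"
      "no_three_chain r (below P a b)"
  proof -
    have "(a, Suc b) \<in> boundary ?B" "(Suc a, b) \<in> boundary ?B" "(a, b) \<in> boundary ?B"
      using bc by (simp_all add: br)
    note this[THEN boundaryD, THEN avoider_below(1)[OF F' P]]
    then show "no_three_chain r (below P a (Suc b))" "no_three_chain r (below P (Suc a) b)"
      "no_three_chain r (below P a b)"
      by blast+
  qed
  have card: "card (below P a b) = snd \<alpha>" "card (below P a (Suc b)) = snd ?\<beta>"
      "card (below P (Suc a) b) = snd ?\<delta>"
    by (simp_all flip: lab\<alpha>) (simp_all add: lab_def)
  have wd: "width r (below P a b) = fst \<alpha>" "width r (below P a (Suc b)) = fst ?\<beta>"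
      "width r (below P (Suc a) b) = fst ?\<delta>"
    by (simp_all flip: lab\<alpha>) (simp_all add: lab_def)
  have finb: "finite (below P u v)" for u v using fin by (rule finite_below)
  \<comment> \<open>If \<open>d\<close> holds, the count identity and the four steps force
    \<open>\<beta>\<close> and \<open>\<delta>\<close> to have the same count as
    \<open>\<alpha>\<close>.\<close>
  have no_dot: "\<not> d" if "snd \<alpha> \<noteq> snd ?\<beta> \<or> snd \<alpha> \<noteq> snd ?\<delta>"
    using iv that g by (auto simp: step_def split: if_splits)
  define Q where "Q = (if d then insert ?e P else P)"
  have Qsub: "Q \<subseteq> B" using PB eB by (auto simp: Q_def)
  have QP: "Q - {?e} = P" using eP by (auto simp: Q_def)
  have below_Q: "below Q u v = below P u v" if "u = 0 \<or> v = 0 \<or> (u, v) \<in> ?B" for u v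
    using below_remove_corner[OF F that, of Q] QP by simp
  have avQ: "partial_perm Q \<and> no_three_chain r (below Q (Suc a) (Suc b))"
  proof (rule cell_cases[OF PB(2) fin, of a b])
    assume c: "below P a (Suc b) = below P a b" "below P (Suc a) b = below P a b"
      "below P (Suc a) (Suc b) = below P a b"
    show ?thesis
    proof (cases d)
      case False
      then show ?thesis using c av PB by (simp add: Q_def)
    next
      case True
      have "?\<beta> = \<alpha>" "?\<delta> = \<alpha>" using c lab\<alpha> by simp_all
      moreover have "snd ?\<gamma> = Suc (snd \<alpha>)" using iv True calculation by simp
      ultimately have "bk (width r (below P a b)) (card (below P a b)) (fst ?\<gamma>) = (\<alpha>, True)"
        using \<alpha> True lab\<alpha> by (simp add: inv_rule_def card wd)
      \<comment> \<open>As the cell is a corner, every dot of its row or column lies in the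
        rectangle below it, and in this case that rectangle contains no dot outside
        \<open>below P a b\<close>. So a dot may be added.\<close>
      moreover have row: "snd x \<noteq> Suc b" "fst x \<noteq> Suc a" if "x \<in> P" for x
      proof -
        have xB: "(fst x, snd x) \<in> B" using that PB(1) by auto
        have "fst x \<le> Suc a" if "snd x = Suc b"
        proof (rule ccontr)
          assume "\<not> ?thesis"
          then have "(Suc (Suc a), Suc b) \<in> B"
            using that ferrersD(3)[OF F(1) xB, of "Suc (Suc a)" "Suc b"] by simp
          then show False using F(2) by (simp add: corner_def)
        qed
        moreover have "snd x \<le> Suc b" if "fst x = Suc a"
        proof (rule ccontr)
          assume "\<not> ?thesis"
          then have "(Suc a, Suc (Suc b)) \<in> B"
            using that ferrersD(3)[OF F(1) xB, of "Suc a" "Suc (Suc b)"] by simp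
          then show False using F(2) by (simp add: corner_def)
        qed
        ultimately have *: "fst x \<le> Suc a \<and> snd x \<le> Suc b" if "snd x = Suc b \<or> fst x = Suc a"
          using that by auto
        have "\<not> (fst x \<le> Suc a \<and> snd x \<le> Suc b) \<or> fst x \<le> a \<and> snd x \<le> b"
          using c(3) that unfolding below_def by blast
        then show "snd x \<noteq> Suc b" "fst x \<noteq> Suc a" using * by auto
      qed
      moreover have "\<forall>s\<in>below P a b. inc s ?e" by (auto simp: below_def inc_def)
      ultimately have "no_three_chain r (insert ?e (below P a b))"
        using dot_avoid[OF finb] av by blast
      moreover have "below Q (Suc a) (Suc b) = insert ?e (below P a b)"
      proof -
        have "below Q (Suc a) (Suc b) = insert ?e (below P (Suc a) (Suc b))"
          using True by (auto simp: Q_def below_def)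
        then show ?thesis using c(3) by simp
      qed
      moreover have "partial_perm Q"
      proof -
        have "Suc a \<notin> fst ` (P - {?e})" "Suc b \<notin> snd ` (P - {?e})" using row by (metis DiffE imageE)+
        then show ?thesis using PB(2) True by (simp add: Q_def partial_perm_def)
      qed
      ultimately show ?thesis by simp
    qed
  next
    fix p assume c: "p \<notin> below P a b" "below P a (Suc b) = insert p (below P a b)"
      "below P (Suc a) (Suc b) = insert p (below P a b)"
    then have "\<not> d" using no_dot card finb by auto
    then show ?thesis using c av PB by (simp add: Q_def)
  next
    fix q assume c: "q \<notin> below P a b" "below P (Suc a) b = insert q (below P a b)"
      "below P (Suc a) (Suc b) = insert q (below P a b)"
    then have "\<not> d" using no_dot card finb by auto
    then show ?thesis using c av PB by (simp add: Q_def)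
  next
    fix p q assume c: "hook (below P a b) p q" "below P a (Suc b) = insert p (below P a b)"
      "below P (Suc a) b = insert q (below P a b)"
      "below P (Suc a) (Suc b) = insert p (insert q (below P a b))"
    note hs = hook_simps[OF c(1)]
    have cd: "snd ?\<beta> = Suc (snd \<alpha>)" "snd ?\<delta> = Suc (snd \<alpha>)"
      using card c hs by auto
    then have nd: "\<not> d" using no_dot by simp
    then have "snd ?\<gamma> = Suc (Suc (snd \<alpha>))" using iv cd by simp
    then have "width r (insert p (below P a b)) \<noteq> width r (insert q (below P a b)) \<or>
        bk (width r (insert p (below P a b))) (Suc (card (below P a b))) (fst ?\<gamma>) = (lab r (below P a b), False)"
      using \<alpha> nd cd wd card lab\<alpha> by (auto simp: inv_rule_def simp flip: c(2,3) split: if_splits)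
    then have "no_three_chain r (insert p (insert q (below P a b)))"
      using hook_avoid[OF c(1)] av c(2,3) by simp
    then show ?thesis using nd c(4) PB by (simp add: Q_def)
  qed (use eP in auto)
  have "avoider r B Q"
    unfolding avoider_def
  proof (intro conjI)
    show "\<forall>(u, v)\<in>B. no_three_chain r (below Q u v)"
    proof clarify
      fix u v assume "(u, v) \<in> B"
      then show "no_three_chain r (below Q u v)"
        using avQ below_Q[of u v] avoider_below(1)[OF F' P, of u v] by (cases "(u, v) = ?e") auto
    qed
  qed (use avQ Qsub in auto)
  moreover have "lab r (below Q u v) = l u v" if uv: "(u, v) \<in> boundary B" for u v
  proof (cases "(u, v) = ?e")
    case False
    then have m: "(u, v) \<in> boundary ?B" using uv unfolding br by blast
    have "(u, v) \<noteq> (a, b)" using bc(4) uv by metis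
    then show ?thesis using lP[OF m] below_Q[OF boundaryD[OF m]] by auto
  next
    case True
    have finQ: "finite Q" using fin by (simp add: Q_def)
    have lQ: "lab r (below Q a b) = \<alpha>" "lab r (below Q a (Suc b)) = ?\<beta>" "lab r (below Q (Suc a) b) = ?\<delta>"
    proof -
      have "(a, Suc b) \<in> boundary ?B" "(Suc a, b) \<in> boundary ?B" "(a, b) \<in> boundary ?B"
        using bc by (simp_all add: br)
      note this[THEN boundaryD, THEN below_Q]
      then show "lab r (below Q a b) = \<alpha>" "lab r (below Q a (Suc b)) = ?\<beta>" "lab r (below Q (Suc a) b) = ?\<delta>"
        using lab\<alpha> by simp_all
    qed
    have "?e \<in> Q \<longleftrightarrow> d" using eP by (simp add: Q_def)
    then have i: "inv_rule bk ?\<beta> ?\<delta> (lab r (below Q (Suc a) (Suc b))) = (\<alpha>, d)"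
      using inv_rule_below[of Q a b] avQ finQ lQ by simp
    have gQ: "good_labels B (\<lambda>a b. lab r (below Q a b))"
      by (rule good_labels_avoider[OF F(1) \<open>avoider r B Q\<close>])
    then have "valid (lab r (below Q (Suc a) (Suc b)))"
        "step ?\<beta> (lab r (below Q (Suc a) (Suc b)))" "step ?\<delta> (lab r (below Q (Suc a) (Suc b)))"
      using bc lQ unfolding good_labels_def by (metis (no_types, lifting) case_prodD)+
    then have "lab r (below Q (Suc a) (Suc b)) = ?\<gamma>"
      using inv_rule_inj g i \<alpha> by metis
    then show ?thesis using True by simp
  qed
  ultimately show ?case by blast
qed

end

section \<open>Symmetric placements\<close>

text \<open>Supplies two neighbouring boundary points, the ends of the top edge of column
  \<open>Suc a\<close>.\<close>

lemma column_top:
  assumes "ferrers B" "(Suc a, y) \<in> B"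
  obtains h where "(Suc a, h) \<in> boundary B" "(a, h) \<in> boundary B" "\<And>y. (Suc a, y) \<in> B \<Longrightarrow> y \<le> h"
proof -
  define Y where "Y = {y. (Suc a, y) \<in> B}"
  have "Y = (\<lambda>y. (Suc a, y)) -` B" by (auto simp: Y_def)
  then have fin: "finite Y"
    using assms(1) by (auto simp: ferrers_def intro!: finite_vimageI injI)
  define h where "h = Max Y"
  have h: "(Suc a, h) \<in> B" using Max_in[OF fin] assms(2) by (auto simp: h_def Y_def)
  have le: "y \<le> h" if "(Suc a, y) \<in> B" for y
    using fin that by (auto simp: h_def Y_def)
  have "(Suc a, Suc h) \<notin> B" using le[of "Suc h"] by auto
  moreover from this have "(Suc (Suc a), Suc h) \<notin> B"
    using ferrersD(3)[OF assms(1), of "Suc (Suc a)" "Suc h" "Suc a" "Suc h"] by auto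
  moreover have "a = 0 \<or> (a, h) \<in> B"
    using ferrersD(3)[OF assms(1) h, of a h] ferrersD(2)[OF assms(1) h] by auto
  ultimately show ?thesis using that[of h] le h by (auto simp: boundary_def)
qed

text \<open>The count increases along the top edge of a column exactly when the column contains a
  dot.\<close>

lemma fst_image_subset:
  assumes "ferrers B" "P \<subseteq> B" "Q \<subseteq> B"
    and eq: "\<And>a b. (a, b) \<in> boundary B \<Longrightarrow> card (below P a b) = card (below Q a b)"
  shows "fst ` P \<subseteq> fst ` Q"
proof
  fix x assume "x \<in> fst ` P"
  then obtain y where xy: "(x, y) \<in> P" by auto
  then have xyB: "(x, y) \<in> B" using assms(2) by blast
  then obtain a where a: "x = Suc a" using ferrersD(1)[OF assms(1)] gr0_implies_Suc by blast
  obtain h where h: "(Suc a, h) \<in> boundary B" "(a, h) \<in> boundary B" "\<And>y. (Suc a, y) \<in> B \<Longrightarrow> y \<le> h"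
    using column_top[OF assms(1) xyB[unfolded a]] by blast
  have finP: "finite P" using assms(1,2) finite_subset unfolding ferrers_def by blast
  have yh: "y \<le> h" using h(3) xyB a by blast
  have "below P a h \<subset> below P (Suc a) h"
  proof
    show "below P a h \<subseteq> below P (Suc a) h" by (auto simp: below_def)
    have "(x, y) \<in> below P (Suc a) h" "(x, y) \<notin> below P a h"
      using xy yh a by (auto simp: below_def)
    then show "below P a h \<noteq> below P (Suc a) h" by blast
  qed
  then have "card (below P a h) < card (below P (Suc a) h)"
    by (intro psubset_card_mono finite_below finP)
  then have "below Q a h \<noteq> below Q (Suc a) h" using eq h(1,2) by auto
  then have "{q \<in> Q. fst q = Suc a \<and> snd q \<le> h} \<noteq> {}" unfolding below_Suc_col by blast
  then show "x \<in> fst ` Q" using a by force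
qed

lemma below_swap: "below (prod.swap ` P) b a = prod.swap ` below P a b"
  by (force simp: below_def)

lemma boundary_swap:
  assumes "prod.swap ` B = B"
  shows "(a, b) \<in> boundary B \<longleftrightarrow> (b, a) \<in> boundary B"
proof -
  have "(x, y) \<in> B \<longleftrightarrow> (y, x) \<in> B" for x y
    using assms by (metis image_eqI swap_simp)
  then show ?thesis by (auto simp: boundary_def)
qed

lemma partial_perm_swap:
  assumes "partial_perm P"
  shows "partial_perm (prod.swap ` P)"
proof -
  have "fst \<circ> prod.swap = (snd :: nat \<times> nat \<Rightarrow> nat)" "snd \<circ> prod.swap = (fst :: nat \<times> nat \<Rightarrow> nat)"
    by auto
  then show ?thesis
    using assms inj_on_imageI[of fst prod.swap P] inj_on_imageI[of snd prod.swap P]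
    by (simp add: partial_perm_def)
qed

definition symmetric_avoiders ::
  "(nat \<times> nat \<Rightarrow> nat \<times> nat \<Rightarrow> bool) \<Rightarrow> (nat \<times> nat) set \<Rightarrow> (nat \<times> nat) set set" where
  "symmetric_avoiders r B = {P. avoider r B P \<and> prod.swap ` P = P}"

context growth_rule
begin

lemma lab_swap:
  assumes "finite S"
  shows "lab r (prod.swap ` S) = lab r S"
proof -
  have le: "width r X \<le> width r (prod.swap ` X)" if fin: "finite X" for X
  proof (rule width_le)
    fix C assume "C \<subseteq> X" "free r C"
    then have "card (prod.swap ` C) \<le> width r (prod.swap ` X)"
      using fin free_swap by (intro width_ge) auto
    then show "card C \<le> width r (prod.swap ` X)"
      by (simp add: card_image)
  qed (use fin in auto)
  have "width r (prod.swap ` S) = width r S"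
    using le[of S] le[of "prod.swap ` S"] assms by (simp add: image_image)
  then show ?thesis by (simp add: lab_def card_image)
qed

lemma avoider_swap:
  assumes "prod.swap ` B = B" "avoider r B P"
  shows "avoider r B (prod.swap ` P)"
  unfolding avoider_def
proof (intro conjI ballI)
  show "prod.swap ` P \<subseteq> B" using assms by (auto simp: avoider_def)
  show "partial_perm (prod.swap ` P)" using assms by (simp add: avoider_def partial_perm_swap)
  fix w assume "w \<in> B"
  moreover obtain a b where w: "w = (a, b)" by fastforce
  ultimately have "(b, a) \<in> B" using assms(1) by (metis image_eqI swap_simp)
  then have "no_three_chain r (prod.swap ` below P b a)"
    using assms(2) by (auto simp: avoider_def intro!: no_three_chain_swap)
  then show "case w of (a, b) \<Rightarrow> no_three_chain r (below (prod.swap ` P) a b)"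
    by (simp add: below_swap w)
qed

lemma avoider_symmetric:
  assumes "ferrers B" "prod.swap ` B = B" "avoider r B P"
    and "\<And>a b. (a, b) \<in> boundary B \<Longrightarrow> lab r (below P a b) = lab r (below P b a)"
  shows "prod.swap ` P = P"
proof (rule avoider_unique[OF assms(1) avoider_swap[OF assms(2,3)] assms(3)])
  fix a b assume ab: "(a, b) \<in> boundary B"
  have "finite P" using assms(1,3) finite_subset unfolding ferrers_def avoider_def by blast
  then show "lab r (below (prod.swap ` P) a b) = lab r (below P a b)"
    by (simp add: below_swap lab_swap finite_below assms(4)[OF ab])
qed

end

lemma symmetric_avoiders_transfer:
  assumes "growth_rule r bk" "growth_rule r' bk'" "ferrers B" "prod.swap ` B = B"
  obtains \<phi> where "inj_on \<phi> (symmetric_avoiders r B)"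
    "\<And>P. P \<in> symmetric_avoiders r B \<Longrightarrow> \<phi> P \<in> symmetric_avoiders r' B"
    "\<And>P. P \<in> symmetric_avoiders r B \<Longrightarrow> fst ` \<phi> P = fst ` P"
proof -
  interpret G: growth_rule r bk by fact
  interpret G2: growth_rule r' bk' by fact
  have "\<exists>Q. Q \<in> symmetric_avoiders r' B
      \<and> (\<forall>(a, b)\<in>boundary B. lab r' (below Q a b) = lab r (below P a b))"
    if P: "P \<in> symmetric_avoiders r B" for P
  proof -
    have av: "avoider r B P" and sym: "prod.swap ` P = P" using P by (auto simp: symmetric_avoiders_def)
    have finP: "finite P" using assms(3) av finite_subset unfolding ferrers_def avoider_def by blast
    obtain Q where Q: "avoider r' B Q"
      "\<forall>(a, b)\<in>boundary B. lab r' (below Q a b) = lab r (below P a b)"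
      using G2.avoider_exists[OF assms(3) G.good_labels_avoider[OF assms(3) av]] by blast
    have "prod.swap ` Q = Q"
    proof (rule G2.avoider_symmetric[OF assms(3,4) Q(1)])
      fix a b assume ab: "(a, b) \<in> boundary B"
      then have ba: "(b, a) \<in> boundary B" using boundary_swap[OF assms(4)] by blast
      have "lab r (below P a b) = lab r (below P b a)"
        using G.lab_swap[OF finite_below[OF finP], of a b] below_swap[of P b a] sym by simp
      then show "lab r' (below Q a b) = lab r' (below Q b a)" using bspec[OF Q(2) ab] bspec[OF Q(2) ba] by simp
    qed
    then show ?thesis using Q by (auto simp: symmetric_avoiders_def)
  qed
  then have "\<exists>\<phi>. \<forall>P\<in>symmetric_avoiders r B. \<phi> P \<in> symmetric_avoiders r' B
      \<and> (\<forall>(a, b)\<in>boundary B. lab r' (below (\<phi> P) a b) = lab r (below P a b))"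
    by (intro bchoice ballI)
  then obtain \<phi> where \<phi>': "\<forall>P\<in>symmetric_avoiders r B. \<phi> P \<in> symmetric_avoiders r' B
      \<and> (\<forall>(a, b)\<in>boundary B. lab r' (below (\<phi> P) a b) = lab r (below P a b))"
    by (rule exE)
  then have \<phi>: "\<And>P. P \<in> symmetric_avoiders r B \<Longrightarrow> \<phi> P \<in> symmetric_avoiders r' B"
    and lab: "\<And>P a b. P \<in> symmetric_avoiders r B \<Longrightarrow> (a, b) \<in> boundary B \<Longrightarrow>
        lab r' (below (\<phi> P) a b) = lab r (below P a b)"
    by blast+
  show ?thesis
  proof (rule that[OF _ \<phi>])
    show "inj_on \<phi> (symmetric_avoiders r B)"
    proof (rule inj_onI)
      fix P Q assume PQ: "P \<in> symmetric_avoiders r B" "Q \<in> symmetric_avoiders r B" "\<phi> P = \<phi> Q"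
      then have "avoider r B P" "avoider r B Q" by (auto simp: symmetric_avoiders_def)
      then show "P = Q"
        by (rule G.avoider_unique[OF assms(3)]) (metis lab PQ)
    qed
    fix P assume P: "P \<in> symmetric_avoiders r B"
    have sub: "P \<subseteq> B" "\<phi> P \<subseteq> B" using P \<phi>[OF P] by (auto simp: symmetric_avoiders_def avoider_def)
    have "card (below (\<phi> P) a b) = card (below P a b)" if "(a, b) \<in> boundary B" for a b
      using lab[OF P that] by (simp add: lab_def)
    then show "fst ` \<phi> P = fst ` P"
      by (intro equalityI fst_image_subset[OF assms(3)] sub) simp_all
  qed
qed

text \<open>\<open>W\<close> is the family of all dot sets that realise a tail; every box of the core has one of
  them to its north-east.\<close>

definition core :: "(nat \<times> nat) set set \<Rightarrow> (nat \<times> nat) set \<Rightarrow> (nat \<times> nat) set \<Rightarrow> (nat \<times> nat) set" where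
  "core W M P = {(x, y) \<in> M. \<exists>w\<in>W. w \<subseteq> P \<and> (\<forall>d\<in>w. x < fst d \<and> y < snd d)}"

definition tail_avoiders ::
  "(nat \<times> nat \<Rightarrow> nat \<times> nat \<Rightarrow> bool) \<Rightarrow> (nat \<times> nat) set set \<Rightarrow> (nat \<times> nat) set \<Rightarrow> (nat \<times> nat) set set" where
  "tail_avoiders r W M = {P. P \<subseteq> M \<and> partial_perm P \<and> prod.swap ` P = P
     \<and> (\<forall>(a, b)\<in>core W M P. no_three_chain r (below P a b))}"

section \<open>Exchanging the dots inside the core\<close>

lemma core_subset: "core W M P \<subseteq> M"
  by (auto simp: core_def)

lemma ferrers_core:
  assumes "ferrers M"
  shows "ferrers (core W M P)"
  unfolding ferrers_def
proof (intro conjI allI impI)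
  show "finite (core W M P)"
    by (rule finite_subset[OF core_subset]) (use assms in \<open>simp add: ferrers_def\<close>)
  show "0 < x" "0 < y" if "(x, y) \<in> core W M P" for x y
    using ferrersD(1,2)[OF assms subsetD[OF core_subset that]] .
  fix x y x' y' assume a: "(x, y) \<in> core W M P" "0 < x'" "x' \<le> x" "0 < y'" "y' \<le> y"
  then obtain w where w: "(x, y) \<in> M" "w \<in> W" "w \<subseteq> P" "\<forall>d\<in>w. x < fst d \<and> y < snd d"
    unfolding core_def by blast
  have "(x', y') \<in> M" using ferrersD(3)[OF assms w(1)] a by blast
  moreover have "\<forall>d\<in>w. x' < fst d \<and> y' < snd d" using w(4) a by fastforce
  ultimately show "(x', y') \<in> core W M P" using w(2,3) unfolding core_def by blast
qed

lemma core_image_swap: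
  assumes M: "prod.swap ` M = M" and P: "prod.swap ` P = P"
  shows "core (image prod.swap ` W) M P = prod.swap ` core W M P"
proof -
  have sub: "prod.swap ` core V M P \<subseteq> core (image prod.swap ` V) M P" for V
  proof
    fix z assume "z \<in> prod.swap ` core V M P"
    then obtain x y where z: "z = (y, x)" and xy: "(x, y) \<in> core V M P" by force
    obtain w where w: "(x, y) \<in> M" "w \<in> V" "w \<subseteq> P" "\<forall>d\<in>w. x < fst d \<and> y < snd d"
      using xy unfolding core_def by blast
    have "(y, x) \<in> M" using w(1) M by (metis image_eqI swap_simp)
    moreover have "prod.swap ` w \<subseteq> P" using w(3) P by (metis image_mono)
    moreover have "\<forall>d\<in>prod.swap ` w. y < fst d \<and> x < snd d" using w(4) by auto
    ultimately show "z \<in> core (image prod.swap ` V) M P" using w(2) unfolding core_def z by blast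
  qed
  have "prod.swap ` core (image prod.swap ` W) M P \<subseteq> core W M P"
    using sub[of "image prod.swap ` W"] by (simp add: image_image)
  then have "core (image prod.swap ` W) M P \<subseteq> prod.swap ` core W M P"
    using image_mono[of _ _ prod.swap] by (fastforce simp: image_image)
  then show ?thesis using sub[of W] by blast
qed

lemma core_swap:
  assumes "prod.swap ` M = M" "prod.swap ` P = P" "\<And>w. w \<in> W \<Longrightarrow> prod.swap ` w \<in> W"
  shows "prod.swap ` core W M P = core W M P"
proof -
  have "w \<in> image prod.swap ` W" if "w \<in> W" for w
    using assms(3)[OF that] by (intro image_eqI[of _ _ "prod.swap ` w"]) (simp_all add: image_image)
  then have "image prod.swap ` W = W" using assms(3) by blast
  then show ?thesis using core_image_swap[OF assms(1,2), of W] by simp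
qed

text \<open>Moving to the copy of a tail seen from one of its dots inside the core eventually leads
  to a copy outside the core.\<close>

lemma core_witness_outside:
  assumes "ferrers M" "(x, y) \<in> core W M P"
  shows "\<exists>w\<in>W. w \<subseteq> P - core W M P \<and> (\<forall>d\<in>w. x < fst d \<and> y < snd d)"
proof -
  have "finite (core W M P)" using ferrers_core[OF assms(1)] by (simp add: ferrers_def)
  then have fin: "finite (fst ` core W M P)" by simp
  show ?thesis
    using assms(2)
  \<comment> \<open>Each move goes strictly to the right and stays inside the core, so the column is
    bounded by the last column of the core.\<close>
  proof (induction "Max (fst ` core W M P) - x" arbitrary: x y rule: less_induct)
    case less
    then obtain w where w: "w \<in> W" "w \<subseteq> P" "\<forall>d\<in>w. x < fst d \<and> y < snd d"
      unfolding core_def by blast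
    show ?case
    proof (cases "w \<inter> core W M P = {}")
      case False
      then obtain u v where uv: "(u, v) \<in> w" "(u, v) \<in> core W M P" by auto
      have lt: "x < u" "y < v" using w(3) uv(1) by auto
      have "u \<le> Max (fst ` core W M P)" using fin uv(2) by (intro Max_ge) force+
      then have "Max (fst ` core W M P) - u < Max (fst ` core W M P) - x" using lt by simp
      from less.hyps[OF this uv(2)] obtain w' where
        "w' \<in> W" "w' \<subseteq> P - core W M P" "\<forall>d\<in>w'. u < fst d \<and> v < snd d" by blast
      then show ?thesis using lt by (meson less_trans)
    qed (use w in blast)
  qed
qed

text \<open>Copies outside the core survive the exchange, so the core does not shrink. A copy that
  uses a new dot lies over a box south-west of that dot, and the core, being a Ferrers shape,
  already contained this box; so it does not grow.\<close>

lemma core_replace: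
  assumes "ferrers M" "Q' \<subseteq> core W M P"
  shows "core W M ((P - core W M P) \<union> Q') = core W M P"
proof
  let ?K = "core W M P" and ?Q = "(P - core W M P) \<union> Q'"
  show "?K \<subseteq> core W M ?Q"
  proof
    fix z assume z: "z \<in> ?K"
    obtain x y where xy: "z = (x, y)" by fastforce
    then obtain w where "w \<in> W" "w \<subseteq> P - ?K" "\<forall>d\<in>w. x < fst d \<and> y < snd d"
      using core_witness_outside[OF assms(1)] z by blast
    moreover have "(x, y) \<in> M" using z xy core_subset by blast
    ultimately show "z \<in> core W M ?Q" unfolding xy core_def[of W M ?Q] by blast
  qed
  show "core W M ?Q \<subseteq> ?K"
  proof
    fix z assume "z \<in> core W M ?Q"
    moreover obtain x y where z: "z = (x, y)" by fastforce
    ultimately obtain w where w: "(x, y) \<in> M" "w \<in> W" "w \<subseteq> ?Q" "\<forall>d\<in>w. x < fst d \<and> y < snd d"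
      unfolding core_def[of W M ?Q] by blast
    show "z \<in> ?K"
    proof (cases "w \<inter> Q' = {}")
      case True
      then have "w \<subseteq> P" using w(3) by blast
      then show ?thesis using w z unfolding core_def by blast
    next
      case False
      then obtain d where d: "d \<in> w" "d \<in> ?K" using assms(2) by blast
      then have "(fst d, snd d) \<in> ?K" "x < fst d" "y < snd d" using w(4) by auto
      then show ?thesis
        using ferrersD(3)[OF ferrers_core[OF assms(1)], of "fst d" "snd d" W P x y]
          ferrersD(1,2)[OF assms(1) w(1)] z by simp
    qed
  qed
qed

lemma below_core:
  assumes "ferrers M" "P \<subseteq> M" "(a, b) \<in> core W M P'"
  shows "below (P \<inter> core W M P') a b = below P a b"
proof
  show "below P a b \<subseteq> below (P \<inter> core W M P') a b"
  proof
    fix d assume d: "d \<in> below P a b"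
    then have "(fst d, snd d) \<in> M" "fst d \<le> a" "snd d \<le> b" "d \<in> P" using assms(2) by (auto simp: below_def)
    then have "(fst d, snd d) \<in> core W M P'"
      using ferrersD(3)[OF ferrers_core[OF assms(1)] assms(3), of "fst d" "snd d"]
        ferrersD(1,2)[OF assms(1), of "fst d" "snd d"] by simp
    then show "d \<in> below (P \<inter> core W M P') a b" using d by (auto simp: below_def)
  qed
qed (auto simp: below_def)

lemma snd_image_symmetric: "prod.swap ` P = P \<Longrightarrow> snd ` P = fst ` P"
  by (metis (no_types, lifting) fst_swap image_cong image_image)

lemma symmetric_inj_snd:
  assumes "prod.swap ` P = P" "inj_on fst P"
  shows "partial_perm P"
proof -
  have "inj_on snd P"
  proof (rule inj_onI)
    fix x y assume xy: "x \<in> P" "y \<in> P" "snd x = snd y"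
    then have "prod.swap x \<in> P" "prod.swap y \<in> P" using assms(1) by blast+
    then have "prod.swap x = prod.swap y" using inj_onD[OF assms(2)] xy(3) by simp
    then show "x = y" by (metis swap_swap)
  qed
  then show ?thesis using assms(2) by (simp add: partial_perm_def)
qed

lemma tail_avoiders_transfer:
  assumes r: "growth_rule r bk" "growth_rule r' bk'" and M: "ferrers M" "prod.swap ` M = M"
    and W: "\<And>w. w \<in> W \<Longrightarrow> prod.swap ` w \<in> W"
  obtains F where "inj_on F (tail_avoiders r W M)"
    "\<And>P. P \<in> tail_avoiders r W M \<Longrightarrow> F P \<in> tail_avoiders r' W M"
    "\<And>P. P \<in> tail_avoiders r W M \<Longrightarrow> fst ` F P = fst ` P"
proof -
  \<comment> \<open>The map has to be chosen for every shape simultaneously, because the core varies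
    with the placement.\<close>
  have "\<exists>\<phi>. inj_on \<phi> (symmetric_avoiders r B)
      \<and> (\<forall>P\<in>symmetric_avoiders r B. \<phi> P \<in> symmetric_avoiders r' B \<and> fst ` \<phi> P = fst ` P)"
    if "ferrers B" "prod.swap ` B = B" for B
    using symmetric_avoiders_transfer[OF r that] by metis
  then obtain \<phi> where \<phi>: "\<And>B. ferrers B \<Longrightarrow> prod.swap ` B = B \<Longrightarrow> inj_on (\<phi> B) (symmetric_avoiders r B)"
    "\<And>B P. ferrers B \<Longrightarrow> prod.swap ` B = B \<Longrightarrow> P \<in> symmetric_avoiders r B \<Longrightarrow>
      \<phi> B P \<in> symmetric_avoiders r' B \<and> fst ` \<phi> B P = fst ` P"
    by metis
  define F where "F P = (P - core W M P) \<union> \<phi> (core W M P) (P \<inter> core W M P)" for P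
  have K: "ferrers (core W M P)" "prod.swap ` core W M P = core W M P"
    if "P \<in> tail_avoiders r W M" for P
    using ferrers_core[OF M(1)] core_swap[OF M(2) _ W] that by (auto simp: tail_avoiders_def)
  have PK: "P \<inter> core W M P \<in> symmetric_avoiders r (core W M P)" if P: "P \<in> tail_avoiders r W M" for P
  proof -
    have "prod.swap ` (P \<inter> core W M P) = P \<inter> core W M P"
      using K(2)[OF P] P by (simp add: image_Int tail_avoiders_def)
    moreover have "avoider r (core W M P) (P \<inter> core W M P)"
      unfolding avoider_def
    proof (intro conjI ballI)
      fix w assume w: "w \<in> core W M P"
      obtain a b where ab: "w = (a, b)" by fastforce
      then have "below (P \<inter> core W M P) a b = below P a b"
        using below_core[OF M(1)] P w by (auto simp: tail_avoiders_def)
      then show "case w of (a, b) \<Rightarrow> no_three_chain r (below (P \<inter> core W M P) a b)"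
        using P w ab by (auto simp: tail_avoiders_def)
    qed (use P in \<open>auto simp: tail_avoiders_def partial_perm_def intro: inj_on_subset\<close>)
    ultimately show ?thesis by (simp add: symmetric_avoiders_def)
  qed
  note \<phi>P = \<phi>(2)[OF K PK]
  have \<phi>sub: "\<phi> (core W M P) (P \<inter> core W M P) \<subseteq> core W M P" if "P \<in> tail_avoiders r W M" for P
    using \<phi>P[OF that that that] by (auto simp: symmetric_avoiders_def avoider_def)
  have coreF: "core W M (F P) = core W M P" if "P \<in> tail_avoiders r W M" for P
    unfolding F_def by (rule core_replace[OF M(1) \<phi>sub[OF that]])
  have fstF: "fst ` F P = fst ` P" if P: "P \<in> tail_avoiders r W M" for P
    using \<phi>P[OF P P P] unfolding F_def by (auto simp: image_Un)
  show ?thesis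
  proof (rule that[of F])
    show "fst ` F P = fst ` P" if "P \<in> tail_avoiders r W M" for P by (rule fstF[OF that])
    show "inj_on F (tail_avoiders r W M)"
    proof (rule inj_onI)
      fix P Q assume P: "P \<in> tail_avoiders r W M" and Q: "Q \<in> tail_avoiders r W M" and eq: "F P = F Q"
      \<comment> \<open>The core can be read off from \<open>F P\<close>, so both placements were
        changed by the same map, inside the same shape.\<close>
      have core: "core W M P = core W M Q" using coreF P Q eq by metis
      let ?K = "core W M P"
      have "P - ?K = F P - ?K" "Q - ?K = F Q - ?K"
        using \<phi>sub[OF P] \<phi>sub[OF Q] unfolding F_def core by blast+
      then have 1: "P - ?K = Q - ?K" using eq by simp
      have "\<phi> ?K (P \<inter> ?K) = F P \<inter> ?K" "\<phi> ?K (Q \<inter> ?K) = F Q \<inter> ?K"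
        using \<phi>sub[OF P] \<phi>sub[OF Q] unfolding F_def core by blast+
      then have "P \<inter> ?K = Q \<inter> ?K"
        using inj_onD[OF \<phi>(1)[OF K[OF P]]] PK[OF P] PK[OF Q] eq core by metis
      then show "P = Q" using 1 by blast
    qed
    fix P assume P: "P \<in> tail_avoiders r W M"
    let ?K = "core W M P"
    let ?Q = "\<phi> ?K (P \<inter> ?K)"
    have Q: "avoider r' ?K ?Q" "prod.swap ` ?Q = ?Q" "fst ` ?Q = fst ` (P \<inter> ?K)"
      using \<phi>P[OF P P P] by (auto simp: symmetric_avoiders_def)
    have Pp: "P \<subseteq> M" "inj_on fst P" "prod.swap ` P = P" using P by (auto simp: tail_avoiders_def partial_perm_def)
    have FM: "F P \<subseteq> M" using Pp(1) \<phi>sub[OF P] core_subset unfolding F_def by blast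
    have sym: "prod.swap ` F P = F P"
      using Pp(3) K(2)[OF P] Q(2) by (simp add: F_def image_Un image_set_diff)
    \<comment> \<open>The new dots occupy the columns of the dots they replace, so they do not clash
      with those outside the core; distinct rows then follow by symmetry.\<close>
    have "fst ` (P - ?K) \<inter> fst ` ?Q = {}"
      using Pp(2) unfolding Q(3) by (auto dest: inj_onD)
    moreover have "inj_on fst ?Q" using Q(1) by (simp add: avoider_def partial_perm_def)
    ultimately have "inj_on fst (F P)"
      using Pp(2) unfolding F_def by (auto simp: inj_on_Un intro: inj_on_diff)
    then have "partial_perm (F P)" by (rule symmetric_inj_snd[OF sym])
    moreover have "no_three_chain r' (below (F P) a b)" if ab: "(a, b) \<in> core W M (F P)" for a b
    proof -
      have "F P \<inter> ?K = ?Q" using \<phi>sub[OF P] unfolding F_def by blast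
      then have "below ?Q a b = below (F P) a b"
        using below_core[OF M(1) FM, of a b W P] ab coreF[OF P] by simp
      then show ?thesis using Q(1) ab coreF[OF P] by (auto simp: avoider_def)
    qed
    ultimately show "F P \<in> tail_avoiders r' W M" using FM sym by (auto simp: tail_avoiders_def)
  qed
qed

section \<open>Patterns\<close>

text \<open>Quantifying over zipped pairs lets simplification peel off leading entries; the indexed
  form is \<open>order_iso_nth\<close>.\<close>

definition order_iso :: "nat list \<Rightarrow> nat list \<Rightarrow> bool" where
  "order_iso ys \<sigma> \<longleftrightarrow> length ys = length \<sigma>
     \<and> (\<forall>p\<in>set (zip ys \<sigma>). \<forall>q\<in>set (zip ys \<sigma>). fst p < fst q \<longleftrightarrow> snd p < snd q)"

lemma order_iso_nth:
  "order_iso ys \<sigma> \<longleftrightarrow> length ys = length \<sigma>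
     \<and> (\<forall>i<length \<sigma>. \<forall>j<length \<sigma>. ys ! i < ys ! j \<longleftrightarrow> \<sigma> ! i < \<sigma> ! j)"
  by (auto simp: order_iso_def set_zip) blast+

text \<open>In a permutation of \<open>{1..n}\<close> every entry equals its own rank, and ranks
  depend only on the relative order.\<close>

lemma pattern_of_iff_order_iso:
  assumes "is_pattern \<sigma>"
  shows "pattern_of ys = \<sigma> \<longleftrightarrow> order_iso ys \<sigma>"
proof
  assume eq: "pattern_of ys = \<sigma>"
  have mono: "card {b \<in> set ys. b \<le> x} < card {b \<in> set ys. b \<le> y} \<longleftrightarrow> x < y"
    if "x \<in> set ys" "y \<in> set ys" for x y
  proof
    assume "x < y"
    then have "{b \<in> set ys. b \<le> x} \<subset> {b \<in> set ys. b \<le> y}"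
      using that by (auto simp: psubset_eq dest: order_trans) (use linorder_not_less in blast)
    then show "card {b \<in> set ys. b \<le> x} < card {b \<in> set ys. b \<le> y}"
      by (intro psubset_card_mono) auto
  next
    assume lt: "card {b \<in> set ys. b \<le> x} < card {b \<in> set ys. b \<le> y}"
    show "x < y"
    proof (rule ccontr)
      assume "\<not> x < y"
      then have "{b \<in> set ys. b \<le> y} \<subseteq> {b \<in> set ys. b \<le> x}" by auto
      then have "card {b \<in> set ys. b \<le> y} \<le> card {b \<in> set ys. b \<le> x}" by (intro card_mono) auto
      then show False using lt by simp
    qed
  qed
  show "order_iso ys \<sigma>"
    unfolding order_iso_nth using mono by (auto simp: pattern_of_def simp flip: eq)
next
  assume iso: "order_iso ys \<sigma>"
  define n where "n = length \<sigma>"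
  have len: "length ys = n" and ys: "\<And>i j. i < n \<Longrightarrow> j < n \<Longrightarrow> ys ! i < ys ! j \<longleftrightarrow> \<sigma> ! i < \<sigma> ! j"
    using iso by (auto simp: order_iso_nth n_def)
  have \<sigma>: "distinct \<sigma>" "set \<sigma> = {1..n}"
    using assms by (auto simp: is_pattern_def permutations_of_set_def n_def)
  have le: "ys ! i \<le> ys ! j \<longleftrightarrow> \<sigma> ! i \<le> \<sigma> ! j" if "i < n" "j < n" for i j
    using ys[OF that(2,1)] by linarith
  have inj: "inj_on ((!) ys) {..<n}"
  proof (rule inj_onI)
    fix i j assume ij: "i \<in> {..<n}" "j \<in> {..<n}" "ys ! i = ys ! j"
    then have "\<sigma> ! i = \<sigma> ! j" using le[of i j] le[of j i] by simp
    then show "i = j" using ij \<sigma>(1) by (simp add: nth_eq_iff_index_eq n_def)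
  qed
  have inj\<sigma>: "inj_on ((!) \<sigma>) {..<n}"
    using \<sigma>(1) by (intro inj_onI) (simp add: nth_eq_iff_index_eq n_def)
  have rank: "card {b \<in> set ys. b \<le> ys ! i} = \<sigma> ! i" if i: "i < n" for i
  proof -
    let ?J = "{j \<in> {..<n}. \<sigma> ! j \<le> \<sigma> ! i}"
    have "{b \<in> set ys. b \<le> ys ! i} = (!) ys ` ?J"
      using le i by (auto simp: in_set_conv_nth len)
    then have "card {b \<in> set ys. b \<le> ys ! i} = card ?J"
      using inj by (metis (no_types, lifting) card_image inj_on_subset mem_Collect_eq subsetI)
    also have "\<dots> = card ((!) \<sigma> ` ?J)"
      using inj\<sigma> by (metis (no_types, lifting) card_image inj_on_subset mem_Collect_eq subsetI)
    also have "(!) \<sigma> ` ?J = {t \<in> set \<sigma>. t \<le> \<sigma> ! i}"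
      by (auto simp: in_set_conv_nth n_def)
    also have "\<dots> = {1..\<sigma> ! i}"
      using \<sigma>(2) nth_mem[of i \<sigma>] i by (auto simp: n_def)
    finally show ?thesis by simp
  qed
  show "pattern_of ys = \<sigma>"
    by (rule nth_equalityI) (use rank len in \<open>auto simp: pattern_of_def n_def\<close>)
qed

lemma is_pattern_prefix:
  assumes "is_pattern ([1, 2, 3] @ \<tau>)"
  shows "is_pattern ([3, 2, 1] @ \<tau>)" "\<And>t. t \<in> set \<tau> \<Longrightarrow> 3 < t"
proof -
  have *: "set ([1, 2, 3] @ \<tau>) = {1..length \<tau> + 3}" "distinct ([1, 2, 3] @ \<tau>)"
    using assms by (auto simp: is_pattern_def permutations_of_set_def)
  have "set ([3, 2, 1] @ \<tau>) = set ([1, 2, 3] @ \<tau>)" by auto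
  then show "is_pattern ([3, 2, 1] @ \<tau>)"
    using * by (auto simp: is_pattern_def permutations_of_set_def)
  fix t assume t: "t \<in> set \<tau>"
  then have "t \<in> {1..length \<tau> + 3}" using *(1) by auto
  moreover have "t \<noteq> 1" "t \<noteq> 2" "t \<noteq> 3" using *(2) t by auto
  ultimately show "3 < t" by auto
qed

lemma order_iso_Cons3:
  assumes "\<And>t. t \<in> set \<tau> \<Longrightarrow> 3 < t"
  shows "order_iso (x # y # z # zs) ([1, 2, 3] @ \<tau>) \<longleftrightarrow>
      x < y \<and> y < z \<and> (\<forall>t\<in>set zs. x < t \<and> y < t \<and> z < t) \<and> order_iso zs \<tau>" (is ?A)
    and "order_iso (x # y # z # zs) ([3, 2, 1] @ \<tau>) \<longleftrightarrow>
      y < x \<and> z < y \<and> (\<forall>t\<in>set zs. x < t \<and> y < t \<and> z < t) \<and> order_iso zs \<tau>" (is ?B)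
proof -
  let ?Z = "set (zip zs \<tau>)"
  have t: "3 < snd p" if "p \<in> ?Z" for p
    using assms that by (cases p) (auto dest: set_zip_rightD)
  have set: "(\<forall>t\<in>set zs. P t) \<longleftrightarrow> (\<forall>p\<in>?Z. P (fst p))" if "length zs = length \<tau>" for P
    using that by (metis (no_types, lifting) image_iff list.set_map map_fst_zip)
  \<comment> \<open>The three leading values are at most 3 and all tail values exceed 3, so each
    comparison with the tail reduces to one inequality.\<close>
  have Z: "(\<forall>p\<in>?Z. (k < fst p \<longleftrightarrow> c < snd p) \<and> (fst p < k \<longleftrightarrow> snd p < c)) \<longleftrightarrow> (\<forall>p\<in>?Z. k < fst p)"
    if "c \<le> 3" for k c
    using t that by fastforce
  have gen: "order_iso (x # y # z # zs) ([a, b, c] @ \<tau>) \<longleftrightarrow>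
      (x < y \<longleftrightarrow> a < b) \<and> (y < x \<longleftrightarrow> b < a) \<and> (y < z \<longleftrightarrow> b < c) \<and> (z < y \<longleftrightarrow> c < b)
      \<and> (x < z \<longleftrightarrow> a < c) \<and> (z < x \<longleftrightarrow> c < a)
      \<and> (\<forall>t\<in>set zs. x < t) \<and> (\<forall>t\<in>set zs. y < t) \<and> (\<forall>t\<in>set zs. z < t) \<and> order_iso zs \<tau>"
    if "a \<le> 3" "b \<le> 3" "c \<le> 3" for a b c
  proof (cases "length zs = length \<tau>")
    case True
    note sets = set[OF True]
    show ?thesis
      unfolding sets Z[OF that(1), of x, symmetric] Z[OF that(2), of y, symmetric]
        Z[OF that(3), of z, symmetric]
      by (simp add: order_iso_def True ball_conj_distrib) blast
  qed (simp add: order_iso_def)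
  show ?A using gen[of 1 2 3] by auto
  show ?B using gen[of 3 2 1] by auto
qed

lemma length_ge_3_obtain:
  assumes "length ds = length ([a, b, c] @ \<tau>)"
  obtains d1 d2 d3 es where "ds = d1 # d2 # d3 # es" "length es = length \<tau>"
  using assms by (auto simp: length_Suc_conv)

section \<open>From pattern containment to chains inside the core\<close>

lemma ferrers_boxes:
  assumes "is_shape \<mu>"
  shows "ferrers (boxes \<mu>)"
  unfolding ferrers_def
proof (intro conjI allI impI)
  show "finite (boxes \<mu>)" by (rule finite_boxes)
  show "0 < x" "0 < y" if "(x, y) \<in> boxes \<mu>" for x y using that by (auto simp: boxes_def)
  fix x y x' y' assume a: "(x, y) \<in> boxes \<mu>" "0 < x'" "x' \<le> x" "0 < y'" "y' \<le> y"
  have "\<mu> ! (y - 1) \<le> \<mu> ! (y' - 1)"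
  proof (cases "y' = y")
    case False
    then have "y' - 1 < y - 1" "y - 1 < length \<mu>" using a by (auto simp: boxes_def)
    then show ?thesis using assms unfolding is_shape_def sorted_wrt_iff_nth_less by blast
  qed simp
  then show "(x', y') \<in> boxes \<mu>" using a by (auto simp: boxes_def)
qed

lemma Max_coordinates_in:
  assumes "ferrers M" "finite S" "S \<noteq> {}" "S \<subseteq> M" "(A, B) \<in> M"
    and "\<And>d. d \<in> S \<Longrightarrow> fst d \<le> A \<and> snd d \<le> B"
  shows "(Max (fst ` S), Max (snd ` S)) \<in> M"
proof -
  obtain d where d: "d \<in> S" using assms(3) by blast
  then have "(fst d, snd d) \<in> M" using assms(4) by auto
  note pos = ferrersD(1,2)[OF assms(1) this]
  have "fst d \<le> Max (fst ` S)" "snd d \<le> Max (snd ` S)" using d assms(2) by auto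
  moreover have "Max (fst ` S) \<le> A" "Max (snd ` S) \<le> B" using assms(2,3,6) by auto
  ultimately show ?thesis using ferrersD(3)[OF assms(1,5)] pos by simp
qed

text \<open>For the pattern 123 the tail is empty, and \<open>Max\<close> would be unspecified.\<close>

definition tails :: "nat list set \<Rightarrow> nat list \<Rightarrow> (nat \<times> nat) set set" where
  "tails T \<mu> = {set es | es. \<exists>\<tau>. [1, 2, 3] @ \<tau> \<in> T \<and> sorted_wrt (<) (map fst es)
     \<and> order_iso (map snd es) \<tau>
     \<and> (es \<noteq> [] \<longrightarrow> (Max (fst ` set es), Max (snd ` set es)) \<in> boxes \<mu>)}"

text \<open>The first three dots of an occurrence are a chain of \<open>r\<close>, and the remaining
  ones form a copy of the tail strictly north-east of the rectangle they span. \<open>R\<close> is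
  the condition on the three heights, so that both prefixes are instances.\<close>

lemma contains_prefix_iff:
  assumes shape: "is_shape \<mu>" and P: "P \<subseteq> boxes \<mu>" and pat: "is_pattern ([i, j, k] @ \<tau>)"
    and iso: "\<And>x y z zs. order_iso (x # y # z # zs) ([i, j, k] @ \<tau>) \<longleftrightarrow>
      R x y z \<and> (\<forall>t\<in>set zs. x < t \<and> y < t \<and> z < t) \<and> order_iso zs \<tau>"
    and r: "\<And>d1 d2 d3. r d1 d2 \<and> r d2 d3 \<longleftrightarrow>
      fst d1 < fst d2 \<and> fst d2 < fst d3 \<and> R (snd d1) (snd d2) (snd d3)"
  shows "contains_pattern \<mu> P ([i, j, k] @ \<tau>) \<longleftrightarrow>
    (\<exists>(a, b)\<in>core (tails {[1, 2, 3] @ \<tau>} \<mu>) (boxes \<mu>) P. \<not> no_three_chain r (below P a b))"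
proof
  note F = ferrers_boxes[OF shape]
  assume "contains_pattern \<mu> P ([i, j, k] @ \<tau>)"
  then obtain ds where ds: "length ds = length ([i, j, k] @ \<tau>)" "set ds \<subseteq> P"
    "sorted_wrt (<) (map fst ds)" "pattern_of (map snd ds) = [i, j, k] @ \<tau>"
    "(Max (fst ` set ds), Max (snd ` set ds)) \<in> boxes \<mu>"
    unfolding contains_pattern_def by blast
  obtain d1 d2 d3 es where eq: "ds = d1 # d2 # d3 # es" by (rule length_ge_3_obtain[OF ds(1)])
  have "order_iso (map snd ds) ([i, j, k] @ \<tau>)" using ds(4) pattern_of_iff_order_iso[OF pat] by blast
  then have o: "R (snd d1) (snd d2) (snd d3)" "order_iso (map snd es) \<tau>"
    "\<And>e. e \<in> set es \<Longrightarrow> snd d1 < snd e \<and> snd d2 < snd e \<and> snd d3 < snd e"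
    using iso[of "snd d1" "snd d2" "snd d3" "map snd es"] eq by auto
  have s: "fst d1 < fst d2" "fst d2 < fst d3" "\<And>e. e \<in> set es \<Longrightarrow> fst d3 < fst e"
    "sorted_wrt (<) (map fst es)"
    using ds(3) by (auto simp: eq)
  \<comment> \<open>\<open>(a, b)\<close> is the north-east box of the smallest rectangle that
    starts at the axes and contains the three dots. It belongs to the shape because the whole
    occurrence lies in a rectangular subshape.\<close>
  define a where "a = fst d3"
  define b where "b = max (snd d1) (max (snd d2) (snd d3))"
  have dP: "d1 \<in> P" "d2 \<in> P" "d3 \<in> P" "set es \<subseteq> P" using ds(2) by (auto simp: eq)
  have le: "fst d \<le> Max (fst ` set ds) \<and> snd d \<le> Max (snd ` set ds)" if "d \<in> set ds" for d
    using that by auto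
  have d123: "d1 \<in> set ds" "d2 \<in> set ds" "d3 \<in> set ds" by (auto simp: eq)
  have "(fst d3, snd d3) \<in> boxes \<mu>" using dP(3) P by auto
  from ferrersD(1,2)[OF F this] have "0 < a" "0 < b" by (auto simp: a_def b_def)
  moreover have "a \<le> Max (fst ` set ds)" "b \<le> Max (snd ` set ds)"
    unfolding a_def b_def using le d123 by (meson max.boundedI)+
  ultimately have ab: "(a, b) \<in> boxes \<mu>" using ferrersD(3)[OF F ds(5)] by blast
  have "(Max (fst ` set es), Max (snd ` set es)) \<in> boxes \<mu>" if "es \<noteq> []"
  proof (rule Max_coordinates_in[OF F _ _ _ ds(5)])
    show "set es \<subseteq> boxes \<mu>" using dP(4) P by blast
    show "fst d \<le> Max (fst ` set ds) \<and> snd d \<le> Max (snd ` set ds)" if "d \<in> set es" for d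
      using le that by (simp add: eq)
  qed (use that in auto)
  then have "set es \<in> tails {[1, 2, 3] @ \<tau>} \<mu>"
    using o(2) s(4) unfolding tails_def by blast
  moreover have "\<forall>e\<in>set es. a < fst e \<and> b < snd e" using o(3) s(3) by (auto simp: a_def b_def)
  ultimately have "(a, b) \<in> core (tails {[1, 2, 3] @ \<tau>} \<mu>) (boxes \<mu>) P"
    using ab dP(4) unfolding core_def by blast
  moreover have "\<not> no_three_chain r (below P a b)"
  proof
    assume av: "no_three_chain r (below P a b)"
    have "{d1, d2, d3} \<subseteq> below P a b" using dP s by (auto simp: below_def a_def b_def)
    then show False using no_three_chainD[OF av] r[of d1 d2 d3] s(1,2) o(1) by blast
  qed
  ultimately show "\<exists>(a, b)\<in>core (tails {[1, 2, 3] @ \<tau>} \<mu>) (boxes \<mu>) P. \<not> no_three_chain r (below P a b)"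
    by blast
next
  note F = ferrers_boxes[OF shape]
  assume "\<exists>(a, b)\<in>core (tails {[1, 2, 3] @ \<tau>} \<mu>) (boxes \<mu>) P. \<not> no_three_chain r (below P a b)"
  then obtain a b w where ab: "(a, b) \<in> boxes \<mu>" "\<not> no_three_chain r (below P a b)"
    and w: "w \<in> tails {[1, 2, 3] @ \<tau>} \<mu>" "w \<subseteq> P" "\<forall>d\<in>w. a < fst d \<and> b < snd d"
    unfolding core_def by blast
  obtain d1 d2 d3 where d: "d1 \<in> below P a b" "d2 \<in> below P a b" "d3 \<in> below P a b" "r d1 d2 \<and> r d2 d3"
    using ab(2) unfolding no_three_chain_def by blast
  obtain es where es: "w = set es" "sorted_wrt (<) (map fst es)" "order_iso (map snd es) \<tau>"
    "es \<noteq> [] \<Longrightarrow> (Max (fst ` set es), Max (snd ` set es)) \<in> boxes \<mu>"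
    using w(1) unfolding tails_def by blast
  define ds where "ds = d1 # d2 # d3 # es"
  have dd: "fst d1 < fst d2" "fst d2 < fst d3" "R (snd d1) (snd d2) (snd d3)" using d(4) r by auto
  have db: "fst d' \<le> a" "snd d' \<le> b" "d' \<in> P" if "d' \<in> {d1, d2, d3}" for d'
    using d that by (auto simp: below_def)
  have lt: "fst d' < fst e" "snd d' < snd e" if "d' \<in> {d1, d2, d3}" "e \<in> set es" for d' e
    using db[OF that(1)] w(3) that(2) es(1) by fastforce+
  have sub: "set ds \<subseteq> P" using db w(2) es(1) by (auto simp: ds_def)
  have "order_iso (map snd ds) ([i, j, k] @ \<tau>)"
    using iso[of "snd d1" "snd d2" "snd d3" "map snd es"] dd(3) es(3) lt(2) by (auto simp: ds_def)
  then have "pattern_of (map snd ds) = [i, j, k] @ \<tau>" using pattern_of_iff_order_iso[OF pat] by blast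
  moreover have "length ds = length ([i, j, k] @ \<tau>)" using es(3) by (simp add: ds_def order_iso_def)
  moreover have "sorted_wrt (<) (map fst ds)" using dd(1,2) lt(1) es(2) by (auto simp: ds_def)
  moreover have "(Max (fst ` set ds), Max (snd ` set ds)) \<in> boxes \<mu>"
  \<comment> \<open>A nonempty tail lies north-east of the three dots, so its own bounding box
    certifies the whole occurrence; for an empty tail the box \<open>(a, b)\<close> does.\<close>
  proof (cases "es = []")
    case True
    show ?thesis
    proof (rule Max_coordinates_in[OF F _ _ _ ab(1)])
      show "set ds \<subseteq> boxes \<mu>" using sub P by blast
      show "fst d' \<le> a \<and> snd d' \<le> b" if "d' \<in> set ds" for d'
        using that db[of d'] True by (simp add: ds_def)
    qed (auto simp: ds_def)
  next
    case False
    show ?thesis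
    proof (rule Max_coordinates_in[OF F _ _ _ es(4)[OF False]])
      fix d' assume d': "d' \<in> set ds"
      obtain e where e: "e \<in> set es" using False by (meson hd_in_set)
      have le: "fst e \<le> Max (fst ` set es)" "snd e \<le> Max (snd ` set es)" if "e \<in> set es" for e
        using that by auto
      show "fst d' \<le> Max (fst ` set es) \<and> snd d' \<le> Max (snd ` set es)"
      proof (cases "d' \<in> set es")
        case False
        then have "d' \<in> {d1, d2, d3}" using d' by (auto simp: ds_def)
        then show ?thesis using lt[OF _ e] le[OF e] by (meson less_imp_le order_trans)
      qed (use le in blast)
    qed (use sub P in \<open>auto simp: ds_def\<close>)
  qed
  ultimately show "contains_pattern \<mu> P ([i, j, k] @ \<tau>)"
    using sub unfolding contains_pattern_def by blast
qed

lemma core_Un: "core (V \<union> W) M P = core V M P \<union> core W M P"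
  unfolding core_def by blast

lemma ball_Un_swap:
  assumes "\<And>a b. Q a b \<Longrightarrow> Q b a"
  shows "(\<forall>(a, b)\<in>A \<union> prod.swap ` A. Q a b) \<longleftrightarrow> (\<forall>(a, b)\<in>A. Q a b)"
  unfolding ball_Un using assms by auto

text \<open>The transposed tails are adjoined to make the core self-conjugate. For a symmetric
  placement this changes nothing: the additional boxes are reflections of old ones, and reflection
  preserves the absence of three-chains below a box. The map \<open>f\<close> allows both prefixes
  to be treated at once.\<close>

lemma sym_avoiders_eq:
  assumes r: "growth_rule r bk" and shape: "is_shape \<mu>" and conj: "self_conjugate \<mu>"
    and con: "\<And>P \<tau>. [1, 2, 3] @ \<tau> \<in> T \<Longrightarrow> P \<subseteq> boxes \<mu> \<Longrightarrow>
      contains_pattern \<mu> P (f ([1, 2, 3] @ \<tau>)) \<longleftrightarrow>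
      (\<exists>(a, b)\<in>core (tails {[1, 2, 3] @ \<tau>} \<mu>) (boxes \<mu>) P. \<not> no_three_chain r (below P a b))"
    and T: "\<And>\<sigma>. \<sigma> \<in> T \<Longrightarrow> prefix [1, 2, 3] \<sigma>"
  shows "sym_avoiders \<mu> (f ` T) =
    {P \<in> tail_avoiders r (tails T \<mu> \<union> image prod.swap ` tails T \<mu>) (boxes \<mu>). fst ` P = fst ` boxes \<mu>}"
proof -
  interpret growth_rule r bk by fact
  let ?M = "boxes \<mu>" and ?W = "tails T \<mu>"
  have swM: "prod.swap ` ?M = ?M"
    using conj unfolding self_conjugate_def by (force simp: image_iff)
  have sym: "symmetric_placement P \<longleftrightarrow> prod.swap ` P = P" for P
  proof -
    have "(x, y) \<in> prod.swap ` P \<longleftrightarrow> (y, x) \<in> P" for x y by force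
    then show ?thesis unfolding symmetric_placement_def by (simp add: set_eq_iff) blast
  qed
  \<comment> \<open>With distinct rows and columns, fullness only asks that every column be
    occupied; transposition gives the rows. This is the quantity that the transfer
    preserves.\<close>
  have full: "full_placement \<mu> P \<longleftrightarrow> P \<subseteq> ?M \<and> partial_perm P \<and> fst ` P = fst ` ?M"
    if "prod.swap ` P = P" for P
  proof -
    have "snd ` P = fst ` P" "snd ` ?M = fst ` ?M"
      using that swM by (simp_all add: snd_image_symmetric)
    note im = this
    have pp: "partial_perm P \<longleftrightarrow> (\<forall>x y y'. (x, y) \<in> P \<longrightarrow> (x, y') \<in> P \<longrightarrow> y = y')
        \<and> (\<forall>x x' y. (x, y) \<in> P \<longrightarrow> (x', y) \<in> P \<longrightarrow> x = x')"
      unfolding partial_perm_def inj_on_def by fastforce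
    have ex: "x \<in> fst ` P \<longleftrightarrow> (\<exists>y. (x, y) \<in> P)" "x \<in> snd ` P \<longleftrightarrow> (\<exists>y. (y, x) \<in> P)" for x
      by force+
    show ?thesis
    proof
      assume fp: "full_placement \<mu> P"
      then have "fst ` ?M \<subseteq> fst ` P" unfolding full_placement_def subset_iff ex by blast
      then show "P \<subseteq> ?M \<and> partial_perm P \<and> fst ` P = fst ` ?M"
        using fp image_mono[of P ?M fst] unfolding full_placement_def placement_def pp
        by (meson subset_antisym)
    next
      assume "P \<subseteq> ?M \<and> partial_perm P \<and> fst ` P = fst ` ?M"
      then have a: "P \<subseteq> ?M" "partial_perm P" "fst ` ?M = fst ` P" "snd ` ?M = snd ` P"
        using im by auto
      show "full_placement \<mu> P"
        using a(1,2) unfolding full_placement_def placement_def a(3,4) Ball_def ex pp by blast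
    qed
  qed
  have avoid: "avoids_all \<mu> P (f ` T) \<longleftrightarrow>
      (\<forall>(a, b)\<in>core (?W \<union> image prod.swap ` ?W) ?M P. no_three_chain r (below P a b))"
    if P: "P \<subseteq> ?M" "prod.swap ` P = P" for P
  proof -
    have "avoids_all \<mu> P (f ` T) \<longleftrightarrow> (\<forall>\<tau>. [1, 2, 3] @ \<tau> \<in> T \<longrightarrow> \<not> contains_pattern \<mu> P (f ([1, 2, 3] @ \<tau>)))"
      unfolding avoids_all_def using T by (auto simp: prefix_def)
    also have "\<dots> \<longleftrightarrow> (\<forall>\<tau>. [1, 2, 3] @ \<tau> \<in> T \<longrightarrow>
        (\<forall>(a, b)\<in>core (tails {[1, 2, 3] @ \<tau>} \<mu>) ?M P. no_three_chain r (below P a b)))"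
      using con[OF _ P(1)] by blast
    also have "\<dots> \<longleftrightarrow> (\<forall>(a, b)\<in>core ?W ?M P. no_three_chain r (below P a b))"
    proof -
      have "core ?W ?M P = (\<Union>\<tau>\<in>{\<tau>. [1, 2, 3] @ \<tau> \<in> T}. core (tails {[1, 2, 3] @ \<tau>} \<mu>) ?M P)"
        unfolding core_def tails_def by blast
      then show ?thesis by blast
    qed
    also have "\<dots> \<longleftrightarrow> (\<forall>(a, b)\<in>core (?W \<union> image prod.swap ` ?W) ?M P. no_three_chain r (below P a b))"
    proof -
      have "no_three_chain r (below P b a)" if "no_three_chain r (below P a b)" for a b
        using no_three_chain_swap[OF that] below_swap[of P b a] P(2) by simp
      then show ?thesis
        unfolding core_Un core_image_swap[OF swM P(2)] by (rule ball_Un_swap[symmetric])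
    qed
    finally show ?thesis .
  qed
  show ?thesis
  proof (rule set_eqI)
    fix P
    show "P \<in> sym_avoiders \<mu> (f ` T) \<longleftrightarrow>
        P \<in> {P \<in> tail_avoiders r (?W \<union> image prod.swap ` ?W) ?M. fst ` P = fst ` ?M}"
      unfolding sym_avoiders_def tail_avoiders_def mem_Collect_eq sym
      using full[of P] avoid[of P] by metis
  qed
qed

text \<open>The transfer preserves the occupied columns, so it restricts to placements with a
  prescribed column set. Exchanging the two rules gives the reverse inequality.\<close>

lemma card_tail_avoiders_le:
  assumes "growth_rule r bk" "growth_rule r' bk'" "ferrers M" "prod.swap ` M = M"
    and "\<And>w. w \<in> W \<Longrightarrow> prod.swap ` w \<in> W"
  shows "card {P \<in> tail_avoiders r W M. fst ` P = X} \<le> card {P \<in> tail_avoiders r' W M. fst ` P = X}"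
proof -
  obtain F where F: "inj_on F (tail_avoiders r W M)"
    "\<And>P. P \<in> tail_avoiders r W M \<Longrightarrow> F P \<in> tail_avoiders r' W M"
    "\<And>P. P \<in> tail_avoiders r W M \<Longrightarrow> fst ` F P = fst ` P"
    using tail_avoiders_transfer[OF assms] by blast
  show ?thesis
  proof (rule card_inj_on_le)
    show "inj_on F {P \<in> tail_avoiders r W M. fst ` P = X}"
      by (rule inj_on_subset[OF F(1)]) blast
    show "F ` {P \<in> tail_avoiders r W M. fst ` P = X} \<subseteq> {P \<in> tail_avoiders r' W M. fst ` P = X}"
      using F(2,3) by (simp add: image_subset_iff)
    have "finite (Pow M)" using assms(3) by (simp add: ferrers_def)
    then show "finite {P \<in> tail_avoiders r' W M. fst ` P = X}"
      by (rule finite_subset[rotated]) (auto simp: tail_avoiders_def)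
  qed
qed

theorem theorem5p3:
  fixes T123 T321 :: "nat list set" and \<mu> :: "nat list"
  assumes "\<forall>\<sigma>\<in>T123. is_pattern \<sigma> \<and> prefix [1, 2, 3] \<sigma>"
    and "T321 = replace_123_by_321 ` T123"
    and "is_shape \<mu>" and "self_conjugate \<mu>"
  shows "sym_count \<mu> T123 = sym_count \<mu> T321"
proof -
  let ?W = "tails T123 \<mu> \<union> image prod.swap ` tails T123 \<mu>"
  have pat: "is_pattern ([1, 2, 3] @ \<tau>)" if "[1, 2, 3] @ \<tau> \<in> T123" for \<tau>
    using assms(1) that by blast
  note big = is_pattern_prefix(2)[OF pat]
  have "sym_avoiders \<mu> (id ` T123) = {P \<in> tail_avoiders inc ?W (boxes \<mu>). fst ` P = fst ` boxes \<mu>}"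
  proof (rule sym_avoiders_eq[OF inc.growth_rule_axioms assms(3,4)])
    fix P \<tau> assume a: "[1, 2, 3] @ \<tau> \<in> T123" "P \<subseteq> boxes \<mu>"
    show "contains_pattern \<mu> P (id ([1, 2, 3] @ \<tau>)) \<longleftrightarrow>
      (\<exists>(a, b)\<in>core (tails {[1, 2, 3] @ \<tau>} \<mu>) (boxes \<mu>) P. \<not> no_three_chain inc (below P a b))"
      unfolding id_def
      by (rule contains_prefix_iff[OF assms(3) a(2) pat[OF a(1)], where R = "\<lambda>x y z. x < y \<and> y < z"])
        (use order_iso_Cons3(1)[OF big[OF a(1)]] in \<open>auto simp: inc_def\<close>)
  qed (use assms(1) in blast)
  moreover have "sym_avoiders \<mu> T321 = {P \<in> tail_avoiders dec ?W (boxes \<mu>). fst ` P = fst ` boxes \<mu>}"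
    unfolding assms(2)
  proof (rule sym_avoiders_eq[OF dec.growth_rule_axioms assms(3,4)])
    fix P \<tau> assume a: "[1, 2, 3] @ \<tau> \<in> T123" "P \<subseteq> boxes \<mu>"
    have "replace_123_by_321 ([1, 2, 3] @ \<tau>) = [3, 2, 1] @ \<tau>" by (simp add: replace_123_by_321_def)
    then show "contains_pattern \<mu> P (replace_123_by_321 ([1, 2, 3] @ \<tau>)) \<longleftrightarrow>
      (\<exists>(a, b)\<in>core (tails {[1, 2, 3] @ \<tau>} \<mu>) (boxes \<mu>) P. \<not> no_three_chain dec (below P a b))"
      using contains_prefix_iff[OF assms(3) a(2) is_pattern_prefix(1)[OF pat[OF a(1)]],
          where R = "\<lambda>x y z. y < x \<and> z < y" and r = dec]
        order_iso_Cons3(2)[OF big[OF a(1)]] by (auto simp: dec_def)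
  qed (use assms(1) in blast)
  moreover have M: "ferrers (boxes \<mu>)" "prod.swap ` boxes \<mu> = boxes \<mu>"
    using ferrers_boxes[OF assms(3)] assms(4) by (force simp: self_conjugate_def image_iff)+
  moreover have W: "prod.swap ` w \<in> ?W" if "w \<in> ?W" for w
    using that by (auto simp: image_image)
  ultimately show ?thesis
    using card_tail_avoiders_le[OF inc.growth_rule_axioms dec.growth_rule_axioms M W]
      card_tail_avoiders_le[OF dec.growth_rule_axioms inc.growth_rule_axioms M W]
    by (simp add: sym_count_def le_antisym)
qed

end
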